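(* Let $P$ be a symmetric operad, let $\Phi\in\mathbf{Set}^{\mathbb N}$, and let $\phi:F_\Sigma\Phi\to P$ be a regular epimorphism in the category of symmetric operads. Then the weakening $\mathrm{Wk}_\phi(P)$ of $P$ with respect to $\phi$ is equivalent, as a symmetric $\mathbf{Cat}$-operad (that is, in the 2-category $\mathbf{Cat}\text{-}\Sigma\text{-}\mathbf{Operad}$), to the unbiased weakening $\mathrm{Wk}(P)$.
   Context: A symmetric operad $P$ consists of sets $P_n$ ($n\ge0$), associative compositions $p\circ(p_1,\dots,p_n)$ with unit $1\in P_1$, and (left) actions of the symmetric groups $S_n$ on $P_n$ compatible with composition in the usual way. $U^\Sigma:\Sigma\text{-}\mathbf{Operad}\to\mathbf{Set}^{\mathbb N}$ is the forgetful functor to signatures ($\mathbb N$-indexed families of sets), with left adjoint $F_\Sigma$. A symmetric $\mathbf{Cat}$-operad is defined in the same way with categories $Q_n$ and functors, all axioms holding strictly; $D_*P$ is the symmetric $\mathbf{Cat}$-operad obtained by taking the discrete category on each $P_n$. 2-category $\mathbf{Cat}\text{-}\Sigma\text{-}\mathbf{Operad}$: objects are symmetric $\mathbf{Cat}$-operads; 1-cells are families of functors $\alpha_n:P_n\to Q_n$ strictly preserving composition, unit and symmetric group actions; a transformation $\eta:\alpha\to\beta$ is a family of natural transformations $\eta_n:\alpha_n\to\beta_n$ such that $(\eta)_{p\circ(p_1,\dots,p_n)}=\eta_p\circ(\eta_{p_1},\dots,\eta_{p_n})$, $\eta_{1}=1$, and $\eta_{\sigma\cdot p}=\sigma\cdot\eta_p$.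 Weakening with respect to $\phi:F_\Sigma\Phi\to P$: $\mathrm{Wk}_\phi(P)$ is the (unique up to isomorphism) symmetric $\mathbf{Cat}$-operad in a factorization $D_*F_\Sigma\Phi\xrightarrow{\,b\,}\mathrm{Wk}_\phi(P)\xrightarrow{\,f\,}D_*P$ of $D_*\phi$ with $b$ levelwise bijective on objects and $f$ levelwise full and faithful. The unbiased weakening $\mathrm{Wk}(P)$ is $\mathrm{Wk}_{\epsilon_P}(P)$, where $\epsilon_P:F_\Sigma U^\Sigma P\to P$ is the component at $P$ of the counit of $F_\Sigma\dashv U^\Sigma$. *)

theory Defs
  imports "HOL-Combinatorics.Permutations"
begin

section \<open>Permutations of blocks\<close>

definition offset :: "nat list \<Rightarrow> nat \<Rightarrow> nat" where
  "offset ks i = sum_list (take i ks)"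

definition blocks :: "nat list \<Rightarrow> nat list list" where
  "blocks ks = map (\<lambda>i. [offset ks i ..< offset ks (Suc i)]) [0..<length ks]"

definition list_perm :: "nat list \<Rightarrow> nat \<Rightarrow> nat" where
  "list_perm xs i = (if i < length xs then xs ! i else i)"

text \<open>
  \<open>block_perm \<sigma> ks\<close> sends the \<open>r\<close>-th element of the \<open>i\<close>-th block, for the block sizes
  \<open>permute_list \<sigma> ks\<close>, to the \<open>r\<close>-th element of the \<open>\<sigma> i\<close>-th block, for the block sizes \<open>ks\<close>.
  \<open>sum_perm ks \<sigma>s\<close> is the block sum of the permutations \<open>\<sigma>s\<close>: the \<open>i\<close>-th one acts on the
  \<open>i\<close>-th block.
\<close>

definition block_perm :: "(nat \<Rightarrow> nat) \<Rightarrow> nat list \<Rightarrow> nat \<Rightarrow> nat" where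
  "block_perm \<sigma> ks = list_perm (concat (permute_list \<sigma> (blocks ks)))"

definition sum_perm :: "nat list \<Rightarrow> (nat \<Rightarrow> nat) list \<Rightarrow> nat \<Rightarrow> nat" where
  "sum_perm ks \<sigma>s = list_perm (concat (map2 permute_list \<sigma>s (blocks ks)))"


section \<open>Symmetric operads\<close>

text \<open>
  The sets \<open>Carr P n\<close> need not be disjoint, so an element does not determine its arity.
  Hence composition and action carry arities: \<open>Comp P [k\<^sub>1, \<dots>, k\<^sub>n] p [p\<^sub>1, \<dots>, p\<^sub>n]\<close> is
  the composite for \<open>p\<close> of arity \<open>n\<close> and \<open>p\<^sub>i\<close> of arity \<open>k\<^sub>i\<close>.
  The inputs of an operation of arity \<open>n\<close> are numbered \<open>0, \<dots>, n - 1\<close>, and the symmetric group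
  is the set of \<open>\<sigma>\<close> with \<open>\<sigma> permutes {..<n}\<close>. The left action is read as
  \<open>(\<sigma> \<cdot> p)(x(0), \<dots>, x(n - 1)) = p(x(\<sigma> 0), \<dots>, x(\<sigma> (n - 1)))\<close>, which fixes the form of the
  two equivariance laws.
\<close>

record 'a sym_operad =
  Carr :: "nat \<Rightarrow> 'a set"
  Comp :: "nat list \<Rightarrow> 'a \<Rightarrow> 'a list \<Rightarrow> 'a"
  Unit :: 'a
  Act :: "nat \<Rightarrow> (nat \<Rightarrow> nat) \<Rightarrow> 'a \<Rightarrow> 'a"

abbreviation args :: "(nat \<Rightarrow> 'a set) \<Rightarrow> nat list \<Rightarrow> 'a list \<Rightarrow> bool" where
  "args C \<equiv> list_all2 (\<lambda>k q. q \<in> C k)"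

locale symmetric_operad =
  fixes P :: "'a sym_operad"
  assumes comp_closed:
      "\<lbrakk>p \<in> Carr P (length ks); args (Carr P) ks qs\<rbrakk> \<Longrightarrow> Comp P ks p qs \<in> Carr P (sum_list ks)"
    and unit_closed: "Unit P \<in> Carr P 1"
    and act_closed: "\<lbrakk>\<sigma> permutes {..<n}; p \<in> Carr P n\<rbrakk> \<Longrightarrow> Act P n \<sigma> p \<in> Carr P n"
    and comp_assoc:
      "\<lbrakk>p \<in> Carr P (length kss); args (Carr P) (map length kss) qs;
        list_all2 (args (Carr P)) kss rss\<rbrakk> \<Longrightarrow>
       Comp P (concat kss) (Comp P (map length kss) p qs) (concat rss) =
       Comp P (map sum_list kss) p (map2 (\<lambda>ks (q, rs). Comp P ks q rs) kss (zip qs rss))"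
    and unit_left: "p \<in> Carr P n \<Longrightarrow> Comp P [n] (Unit P) [p] = p"
    and unit_right: "p \<in> Carr P n \<Longrightarrow> Comp P (replicate n 1) p (replicate n (Unit P)) = p"
    and act_id: "p \<in> Carr P n \<Longrightarrow> Act P n id p = p"
    and act_act:
      "\<lbrakk>\<sigma> permutes {..<n}; \<tau> permutes {..<n}; p \<in> Carr P n\<rbrakk> \<Longrightarrow>
       Act P n (\<sigma> \<circ> \<tau>) p = Act P n \<sigma> (Act P n \<tau> p)"
    and comp_act_outer:
      "\<lbrakk>\<sigma> permutes {..<length ks}; p \<in> Carr P (length ks); args (Carr P) ks qs\<rbrakk> \<Longrightarrow>
       Comp P ks (Act P (length ks) \<sigma> p) qs =
       Act P (sum_list ks) (block_perm \<sigma> ks) (Comp P (permute_list \<sigma> ks) p (permute_list \<sigma> qs))"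
    and comp_act_inner:
      "\<lbrakk>list_all2 (\<lambda>k \<sigma>. \<sigma> permutes {..<k}) ks \<sigma>s; p \<in> Carr P (length ks);
        args (Carr P) ks qs\<rbrakk> \<Longrightarrow>
       Comp P ks p (map2 (\<lambda>k (\<sigma>, q). Act P k \<sigma> q) ks (zip \<sigma>s qs)) =
       Act P (sum_list ks) (sum_perm ks \<sigma>s) (Comp P ks p qs)"

locale operad_hom = dom: symmetric_operad P + cod: symmetric_operad Q
  for P :: "'a sym_operad" and Q :: "'b sym_operad" +
  fixes \<alpha> :: "nat \<Rightarrow> 'a \<Rightarrow> 'b"
  assumes hom_closed: "p \<in> Carr P n \<Longrightarrow> \<alpha> n p \<in> Carr Q n"
    and hom_comp:
      "\<lbrakk>p \<in> Carr P (length ks); args (Carr P) ks qs\<rbrakk> \<Longrightarrow>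
       \<alpha> (sum_list ks) (Comp P ks p qs) = Comp Q ks (\<alpha> (length ks) p) (map2 \<alpha> ks qs)"
    and hom_unit: "\<alpha> 1 (Unit P) = Unit Q"
    and hom_act:
      "\<lbrakk>\<sigma> permutes {..<n}; p \<in> Carr P n\<rbrakk> \<Longrightarrow> \<alpha> n (Act P n \<sigma> p) = Act Q n \<sigma> (\<alpha> n p)"


section \<open>Regular epimorphisms of symmetric operads\<close>

text \<open>
  A formula cannot quantify over all types, so the universal property is stated for operads \<open>Z\<close>
  on the type \<open>'x + 'y\<close>. This is no restriction: \<open>coequalizer_universal\<close> below derives the
  universal property for operads on an arbitrary type.
\<close>

definition coequalizer ::
  "'c sym_operad \<Rightarrow> 'x sym_operad \<Rightarrow> 'y sym_operad \<Rightarrow>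
   (nat \<Rightarrow> 'c \<Rightarrow> 'x) \<Rightarrow> (nat \<Rightarrow> 'c \<Rightarrow> 'x) \<Rightarrow> (nat \<Rightarrow> 'x \<Rightarrow> 'y) \<Rightarrow> bool" where
  "coequalizer A X Y u v q \<longleftrightarrow>
     operad_hom A X u \<and> operad_hom A X v \<and> operad_hom X Y q \<and>
     (\<forall>n. \<forall>a\<in>Carr A n. q n (u n a) = q n (v n a)) \<and>
     (\<forall>(Z :: ('x + 'y) sym_operad) h.
        operad_hom X Z h \<and> (\<forall>n. \<forall>a\<in>Carr A n. h n (u n a) = h n (v n a)) \<longrightarrow>
        (\<exists>g. operad_hom Y Z g \<and> (\<forall>n. \<forall>x\<in>Carr X n. g n (q n x) = h n x) \<and>
          (\<forall>g'. operad_hom Y Z g' \<and> (\<forall>n. \<forall>x\<in>Carr X n. g' n (q n x) = h n x) \<longrightarrow>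
             (\<forall>n. \<forall>y\<in>Carr Y n. g' n y = g n y))))"

text \<open>
  The domain of the parallel pair lives on an arbitrary type \<open>'c\<close>, which becomes a parameter:
  for a hypothesis, a free type variable amounts to an existential quantifier over types.
\<close>

definition regular_epi ::
  "'c itself \<Rightarrow> 'x sym_operad \<Rightarrow> 'y sym_operad \<Rightarrow> (nat \<Rightarrow> 'x \<Rightarrow> 'y) \<Rightarrow> bool" where
  "regular_epi TYPE('c) X Y q \<longleftrightarrow> (\<exists>(A :: 'c sym_operad) u v. coequalizer A X Y u v q)"


section \<open>Free symmetric operads\<close>

text \<open>
  The free symmetric operad on a signature \<open>\<Phi>\<close> consists of the linear terms: the elements of
  arity \<open>n\<close> are the terms over \<open>\<Phi>\<close> in which each of the variables \<open>0, \<dots>, n - 1\<close> occurs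
  exactly once. Composition is substitution, with the variables of the \<open>i\<close>-th argument shifted
  into the \<open>i\<close>-th block, and a permutation acts by renaming variables. That this is the free
  operad is \<open>free_operad_universal\<close> below.
\<close>

datatype 'f tm = Var nat | Op 'f "'f tm list"

primrec vars :: "'f tm \<Rightarrow> nat list" where
  "vars (Var i) = [i]"
| "vars (Op f ts) = concat (map vars ts)"

primrec subst :: "(nat \<Rightarrow> 'f tm) \<Rightarrow> 'f tm \<Rightarrow> 'f tm" where
  "subst s (Var i) = s i"
| "subst s (Op f ts) = Op f (map (subst s) ts)"

abbreviation rename :: "(nat \<Rightarrow> nat) \<Rightarrow> 'f tm \<Rightarrow> 'f tm" where
  "rename r \<equiv> subst (\<lambda>i. Var (r i))"

inductive_set terms :: "(nat \<Rightarrow> 'f set) \<Rightarrow> 'f tm set" for \<Phi> where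
  Var: "Var i \<in> terms \<Phi>"
| Op: "\<lbrakk>f \<in> \<Phi> (length ts); \<And>t. t \<in> set ts \<Longrightarrow> t \<in> terms \<Phi>\<rbrakk> \<Longrightarrow> Op f ts \<in> terms \<Phi>"

definition free_operad :: "(nat \<Rightarrow> 'f set) \<Rightarrow> 'f tm sym_operad" where
  "free_operad \<Phi> =
     \<lparr>Carr = \<lambda>n. {t \<in> terms \<Phi>. distinct (vars t) \<and> set (vars t) = {..<n}},
      Comp = \<lambda>ks t us. subst (\<lambda>i. rename (\<lambda>j. offset ks i + j) (us ! i)) t,
      Unit = Var 0,
      Act = \<lambda>n \<sigma> t. rename \<sigma> t\<rparr>"

definition gen :: "nat \<Rightarrow> 'f \<Rightarrow> 'f tm" where
  "gen n f = Op f (map Var [0..<n])"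

text \<open>
  The morphism out of the free operad that extends a map \<open>h\<close> of signatures: evaluate the term
  with its variables read from left to right, then act with the order in which they occur.
\<close>

primrec plain_eval :: "'a sym_operad \<Rightarrow> (nat \<Rightarrow> 'f \<Rightarrow> 'a) \<Rightarrow> 'f tm \<Rightarrow> 'a" where
  "plain_eval P h (Var i) = Unit P"
| "plain_eval P h (Op f ts) =
     Comp P (map (length \<circ> vars) ts) (h (length ts) f) (map (plain_eval P h) ts)"

definition free_lift :: "'a sym_operad \<Rightarrow> (nat \<Rightarrow> 'f \<Rightarrow> 'a) \<Rightarrow> nat \<Rightarrow> 'f tm \<Rightarrow> 'a" where
  "free_lift P h n t = Act P n (list_perm (vars t)) (plain_eval P h t)"

definition counit :: "'a sym_operad \<Rightarrow> nat \<Rightarrow> 'a tm \<Rightarrow> 'a" where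
  "counit P = free_lift P (\<lambda>n p. p)"


section \<open>Symmetric Cat-operads\<close>

record ('o, 'm) category =
  Obj :: "'o set"
  Arr :: "'m set"
  Dom :: "'m \<Rightarrow> 'o"
  Cod :: "'m \<Rightarrow> 'o"
  Idn :: "'o \<Rightarrow> 'm"
  Cmp :: "'m \<Rightarrow> 'm \<Rightarrow> 'm"

definition Hom :: "('o, 'm) category \<Rightarrow> 'o \<Rightarrow> 'o \<Rightarrow> 'm set" where
  "Hom C x y = {f \<in> Arr C. Dom C f = x \<and> Cod C f = y}"

locale category =
  fixes C :: "('o, 'm) category"
  assumes dom_closed: "f \<in> Arr C \<Longrightarrow> Dom C f \<in> Obj C"
    and cod_closed: "f \<in> Arr C \<Longrightarrow> Cod C f \<in> Obj C"
    and idn_hom: "x \<in> Obj C \<Longrightarrow> Idn C x \<in> Hom C x x"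
    and cmp_hom: "\<lbrakk>f \<in> Hom C x y; g \<in> Hom C y z\<rbrakk> \<Longrightarrow> Cmp C g f \<in> Hom C x z"
    and cmp_assoc:
      "\<lbrakk>f \<in> Hom C w x; g \<in> Hom C x y; h \<in> Hom C y z\<rbrakk> \<Longrightarrow>
       Cmp C h (Cmp C g f) = Cmp C (Cmp C h g) f"
    and cmp_idn_right: "f \<in> Hom C x y \<Longrightarrow> Cmp C f (Idn C x) = f"
    and cmp_idn_left: "f \<in> Hom C x y \<Longrightarrow> Cmp C (Idn C y) f = f"

locale cat_functor = dom: category C + cod: category D
  for C :: "('o, 'm) category" and D :: "('o2, 'm2) category" +
  fixes fo :: "'o \<Rightarrow> 'o2" and fa :: "'m \<Rightarrow> 'm2"
  assumes functor_obj: "x \<in> Obj C \<Longrightarrow> fo x \<in> Obj D"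
    and functor_hom: "\<lbrakk>x \<in> Obj C; y \<in> Obj C; f \<in> Hom C x y\<rbrakk> \<Longrightarrow> fa f \<in> Hom D (fo x) (fo y)"
    and functor_idn: "x \<in> Obj C \<Longrightarrow> fa (Idn C x) = Idn D (fo x)"
    and functor_cmp:
      "\<lbrakk>f \<in> Hom C x y; g \<in> Hom C y z\<rbrakk> \<Longrightarrow> fa (Cmp C g f) = Cmp D (fa g) (fa f)"

record ('o, 'm) cat_operad =
  Cat :: "nat \<Rightarrow> ('o, 'm) category"
  OComp :: "nat list \<Rightarrow> 'o \<Rightarrow> 'o list \<Rightarrow> 'o"
  AComp :: "nat list \<Rightarrow> 'm \<Rightarrow> 'm list \<Rightarrow> 'm"
  OUnit :: 'o
  OAct :: "nat \<Rightarrow> (nat \<Rightarrow> nat) \<Rightarrow> 'o \<Rightarrow> 'o"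
  AAct :: "nat \<Rightarrow> (nat \<Rightarrow> nat) \<Rightarrow> 'm \<Rightarrow> 'm"

definition obj_operad :: "('o, 'm) cat_operad \<Rightarrow> 'o sym_operad" where
  "obj_operad Q =
     \<lparr>Carr = \<lambda>n. Obj (Cat Q n), Comp = OComp Q, Unit = OUnit Q, Act = OAct Q\<rparr>"

definition arr_operad :: "('o, 'm) cat_operad \<Rightarrow> 'm sym_operad" where
  "arr_operad Q =
     \<lparr>Carr = \<lambda>n. Arr (Cat Q n), Comp = AComp Q, Unit = Idn (Cat Q 1) (OUnit Q), Act = AAct Q\<rparr>"

text \<open>
  The operad laws are equalities of functors, so they hold iff they hold on objects and on
  arrows. The laws \<open>acomp_hom\<close>, \<open>acomp_idn\<close> and \<open>acomp_cmp\<close> say that composition is a functor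
  from the product of \<open>Cat Q n\<close> and the \<open>Cat Q k\<^sub>i\<close> to \<open>Cat Q (k\<^sub>1 + \<dots> + k\<^sub>n)\<close>.
\<close>

locale sym_cat_operad =
  fixes Q :: "('o, 'm) cat_operad"
  assumes category: "category (Cat Q n)"
    and obj_operad: "symmetric_operad (obj_operad Q)"
    and arr_operad: "symmetric_operad (arr_operad Q)"
    and acomp_hom:
      "\<lbrakk>f \<in> Arr (Cat Q (length ks)); args (\<lambda>k. Arr (Cat Q k)) ks gs\<rbrakk> \<Longrightarrow>
       AComp Q ks f gs \<in> Hom (Cat Q (sum_list ks))
         (OComp Q ks (Dom (Cat Q (length ks)) f) (map2 (\<lambda>k. Dom (Cat Q k)) ks gs))
         (OComp Q ks (Cod (Cat Q (length ks)) f) (map2 (\<lambda>k. Cod (Cat Q k)) ks gs))"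
    and acomp_idn:
      "\<lbrakk>x \<in> Obj (Cat Q (length ks)); args (\<lambda>k. Obj (Cat Q k)) ks ys\<rbrakk> \<Longrightarrow>
       AComp Q ks (Idn (Cat Q (length ks)) x) (map2 (\<lambda>k. Idn (Cat Q k)) ks ys) =
       Idn (Cat Q (sum_list ks)) (OComp Q ks x ys)"
    and acomp_cmp:
      "\<lbrakk>f \<in> Arr (Cat Q (length ks)); f' \<in> Arr (Cat Q (length ks));
        Cod (Cat Q (length ks)) f = Dom (Cat Q (length ks)) f';
        args (\<lambda>k. Arr (Cat Q k)) ks gs; args (\<lambda>k. Arr (Cat Q k)) ks gs';
        map2 (\<lambda>k. Cod (Cat Q k)) ks gs = map2 (\<lambda>k. Dom (Cat Q k)) ks gs'\<rbrakk> \<Longrightarrow>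
       AComp Q ks (Cmp (Cat Q (length ks)) f' f)
         (map2 (\<lambda>k (g', g). Cmp (Cat Q k) g' g) ks (zip gs' gs)) =
       Cmp (Cat Q (sum_list ks)) (AComp Q ks f' gs') (AComp Q ks f gs)"
    and act_functor:
      "\<sigma> permutes {..<n} \<Longrightarrow> cat_functor (Cat Q n) (Cat Q n) (OAct Q n \<sigma>) (AAct Q n \<sigma>)"

definition discrete_category :: "'a set \<Rightarrow> ('a, 'a) category" where
  "discrete_category S =
     \<lparr>Obj = S, Arr = S, Dom = \<lambda>x. x, Cod = \<lambda>x. x, Idn = \<lambda>x. x, Cmp = \<lambda>g f. f\<rparr>"

definition discrete_operad :: "'a sym_operad \<Rightarrow> ('a, 'a) cat_operad" where
  "discrete_operad P =
     \<lparr>Cat = \<lambda>n. discrete_category (Carr P n), OComp = Comp P, AComp = Comp P, OUnit = Unit P,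
      OAct = Act P, AAct = Act P\<rparr>"


section \<open>The 2-category of symmetric Cat-operads\<close>

text \<open>A 1-cell consists of its maps on objects and its maps on arrows.\<close>

type_synonym ('o, 'm, 'o2, 'm2) one_cell = "(nat \<Rightarrow> 'o \<Rightarrow> 'o2) \<times> (nat \<Rightarrow> 'm \<Rightarrow> 'm2)"

locale cat_operad_map = dom: sym_cat_operad P + cod: sym_cat_operad Q
  for P :: "('o, 'm) cat_operad" and Q :: "('o2, 'm2) cat_operad" +
  fixes \<alpha> :: "('o, 'm, 'o2, 'm2) one_cell"
  assumes map_functor: "cat_functor (Cat P n) (Cat Q n) (fst \<alpha> n) (snd \<alpha> n)"
    and map_obj: "operad_hom (obj_operad P) (obj_operad Q) (fst \<alpha>)"
    and map_arr: "operad_hom (arr_operad P) (arr_operad Q) (snd \<alpha>)"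

definition id_map :: "('o, 'm, 'o, 'm) one_cell" where
  "id_map = (\<lambda>n x. x, \<lambda>n f. f)"

definition comp_map ::
  "('o2, 'm2, 'o3, 'm3) one_cell \<Rightarrow> ('o, 'm, 'o2, 'm2) one_cell \<Rightarrow> ('o, 'm, 'o3, 'm3) one_cell"
  where "comp_map \<beta> \<alpha> = (\<lambda>n x. fst \<beta> n (fst \<alpha> n x), \<lambda>n f. snd \<beta> n (snd \<alpha> n f))"

locale cat_operad_transformation = src: cat_operad_map P Q \<alpha> + tgt: cat_operad_map P Q \<beta>
  for P :: "('o, 'm) cat_operad" and Q :: "('o2, 'm2) cat_operad"
    and \<alpha> \<beta> :: "('o, 'm, 'o2, 'm2) one_cell" +
  fixes \<eta> :: "nat \<Rightarrow> 'o \<Rightarrow> 'm2"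
  assumes component:
      "x \<in> Obj (Cat P n) \<Longrightarrow> \<eta> n x \<in> Hom (Cat Q n) (fst \<alpha> n x) (fst \<beta> n x)"
    and natural:
      "f \<in> Hom (Cat P n) x y \<Longrightarrow>
       Cmp (Cat Q n) (\<eta> n y) (snd \<alpha> n f) = Cmp (Cat Q n) (snd \<beta> n f) (\<eta> n x)"
    and component_comp:
      "\<lbrakk>p \<in> Obj (Cat P (length ks)); args (\<lambda>k. Obj (Cat P k)) ks ps\<rbrakk> \<Longrightarrow>
       \<eta> (sum_list ks) (OComp P ks p ps) = AComp Q ks (\<eta> (length ks) p) (map2 \<eta> ks ps)"
    and component_unit: "\<eta> 1 (OUnit P) = Idn (Cat Q 1) (OUnit Q)"
    and component_act:
      "\<lbrakk>\<sigma> permutes {..<n}; p \<in> Obj (Cat P n)\<rbrakk> \<Longrightarrow> \<eta> n (OAct P n \<sigma> p) = AAct Q n \<sigma> (\<eta> n p)"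

definition isomorphic_maps ::
  "('o, 'm) cat_operad \<Rightarrow> ('o2, 'm2) cat_operad \<Rightarrow>
   ('o, 'm, 'o2, 'm2) one_cell \<Rightarrow> ('o, 'm, 'o2, 'm2) one_cell \<Rightarrow> bool" where
  "isomorphic_maps P Q \<alpha> \<beta> \<longleftrightarrow>
     (\<exists>\<eta> \<theta>. cat_operad_transformation P Q \<alpha> \<beta> \<eta> \<and> cat_operad_transformation P Q \<beta> \<alpha> \<theta> \<and>
       (\<forall>n. \<forall>x\<in>Obj (Cat P n).
          Cmp (Cat Q n) (\<theta> n x) (\<eta> n x) = Idn (Cat Q n) (fst \<alpha> n x) \<and>
          Cmp (Cat Q n) (\<eta> n x) (\<theta> n x) = Idn (Cat Q n) (fst \<beta> n x)))"

definition equivalent_cat_operads ::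
  "('o, 'm) cat_operad \<Rightarrow> ('o2, 'm2) cat_operad \<Rightarrow> bool" where
  "equivalent_cat_operads P Q \<longleftrightarrow>
     (\<exists>\<alpha> \<beta>. cat_operad_map P Q \<alpha> \<and> cat_operad_map Q P \<beta> \<and>
       isomorphic_maps P P id_map (comp_map \<beta> \<alpha>) \<and> isomorphic_maps Q Q (comp_map \<alpha> \<beta>) id_map)"


section \<open>Weakenings\<close>

definition bijective_on_objects ::
  "('o, 'm) cat_operad \<Rightarrow> ('o2, 'm2) cat_operad \<Rightarrow> ('o, 'm, 'o2, 'm2) one_cell \<Rightarrow> bool" where
  "bijective_on_objects P Q \<alpha> \<longleftrightarrow> (\<forall>n. bij_betw (fst \<alpha> n) (Obj (Cat P n)) (Obj (Cat Q n)))"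

definition full_and_faithful ::
  "('o, 'm) cat_operad \<Rightarrow> ('o2, 'm2) cat_operad \<Rightarrow> ('o, 'm, 'o2, 'm2) one_cell \<Rightarrow> bool" where
  "full_and_faithful P Q \<alpha> \<longleftrightarrow>
     (\<forall>n. \<forall>x\<in>Obj (Cat P n). \<forall>y\<in>Obj (Cat P n).
        bij_betw (snd \<alpha> n) (Hom (Cat P n) x y) (Hom (Cat Q n) (fst \<alpha> n x) (fst \<alpha> n y)))"

text \<open>
  A weakening is determined only up to isomorphism, so this is a predicate on \<open>W\<close>.
  Weakenings exist: see \<open>weakening_is_weakening\<close> below.
\<close>

definition is_weakening ::
  "(nat \<Rightarrow> 'f set) \<Rightarrow> 'a sym_operad \<Rightarrow> (nat \<Rightarrow> 'f tm \<Rightarrow> 'a) \<Rightarrow> ('o, 'm) cat_operad \<Rightarrow> bool" where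
  "is_weakening \<Phi> P \<phi> W \<longleftrightarrow>
     (\<exists>b f. cat_operad_map (discrete_operad (free_operad \<Phi>)) W b \<and>
       cat_operad_map W (discrete_operad P) f \<and>
       (\<forall>n. \<forall>t\<in>Carr (free_operad \<Phi>) n.
          fst (comp_map f b) n t = \<phi> n t \<and> snd (comp_map f b) n t = \<phi> n t) \<and>
       bijective_on_objects (discrete_operad (free_operad \<Phi>)) W b \<and>
       full_and_faithful W (discrete_operad P) f)"

definition is_unbiased_weakening :: "'a sym_operad \<Rightarrow> ('o, 'm) cat_operad \<Rightarrow> bool" where
  "is_unbiased_weakening P W \<longleftrightarrow> is_weakening (Carr P) P (counit P) W"


section \<open>Properties of block permutations\<close>

lemma length_blocks [simp]: "length (blocks ks) = length ks"
  by (simp add: blocks_def)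

lemma offset_Suc: "i < length ks \<Longrightarrow> offset ks (Suc i) = offset ks i + ks ! i"
  by (simp add: offset_def take_Suc_conv_app_nth)

lemma offset_0 [simp]: "offset ks 0 = 0"
  by (simp add: offset_def)

lemma offset_Cons [simp]: "offset (k # ks) (Suc i) = k + offset ks i"
  by (simp add: offset_def)

lemma offset_append [simp]: "offset (ks @ ls) (length ks + i) = sum_list ks + offset ls i"
  by (simp add: offset_def)

lemma offset_append_less: "i \<le> length ks \<Longrightarrow> offset (ks @ ls) i = offset ks i"
  by (simp add: offset_def)

lemma nth_blocks: "i < length ks \<Longrightarrow> blocks ks ! i = map ((+) (offset ks i)) [0..<ks ! i]"
  by (intro nth_equalityI) (auto simp: blocks_def offset_Suc)

lemma blocks_Cons: "blocks (k # ks) = [0..<k] # map (map ((+) k)) (blocks ks)"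
  by (rule nth_equalityI) (auto simp: nth_blocks nth_Cons map_idI split: nat.split)

lemma concat_blocks: "concat (blocks ks) = [0..<sum_list ks]"
proof (induction ks)
  case Nil
  then show ?case by (simp add: blocks_def)
next
  case (Cons k ks)
  have "concat (blocks (k # ks)) = [0..<k] @ map ((+) k) [0..<sum_list ks]"
    by (simp only: blocks_Cons concat.simps Cons.IH flip: map_concat)
  also have "\<dots> = [0..<sum_list (k # ks)]"
    by (intro nth_equalityI) (auto simp: nth_append)
  finally show ?case .
qed

lemma offset_less:
  "\<lbrakk>i < length ks; r < ks ! i\<rbrakk> \<Longrightarrow> offset ks i + r < sum_list ks"
proof (induction ks arbitrary: i)
  case (Cons k ks)
  then show ?case by (cases i) auto
qed simp

lemma nth_concat_offset:
  "\<lbrakk>i < length xss; j < length (xss ! i)\<rbrakk> \<Longrightarrow>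
   concat xss ! (offset (map length xss) i + j) = xss ! i ! j"
proof (induction xss arbitrary: i)
  case (Cons xs xss)
  then show ?case by (cases i) (auto simp: nth_append)
qed simp

lemma offset_concat:
  "\<lbrakk>i < length kss; j \<le> length (kss ! i)\<rbrakk> \<Longrightarrow>
   offset (concat kss) (offset (map length kss) i + j) =
   offset (map sum_list kss) i + offset (kss ! i) j"
proof (induction kss arbitrary: i)
  case (Cons ks kss)
  then show ?case by (cases i) (auto simp: offset_append_less add.assoc)
qed simp

lemma list_perm_nth: "i < length xs \<Longrightarrow> list_perm xs i = xs ! i"
  by (simp add: list_perm_def)

lemma map_list_perm [simp]: "map (list_perm xs) [0..<length xs] = xs"
  by (rule nth_equalityI) (auto simp: list_perm_def)

lemma list_perm_upt [simp]: "list_perm [0..<n] = id"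
  by (auto simp: list_perm_def fun_eq_iff)

lemma list_perm_permutes:
  assumes "distinct xs" "set xs = {..<n}"
  shows "list_perm xs permutes {..<n}"
proof -
  have n: "length xs = n" using assms by (metis card_lessThan distinct_card)
  have "bij_betw ((!) xs) {..<n} {..<n}"
    by (rule bij_betw_nth) (simp_all only: assms n)
  also have "?this \<longleftrightarrow> bij_betw (list_perm xs) {..<n} {..<n}"
    by (rule bij_betw_cong) (simp add: list_perm_def n)
  finally have "bij_betw (list_perm xs) {..<n} {..<n}" .
  then show ?thesis
    by (rule bij_imp_permutes) (auto simp: list_perm_def n)
qed

lemma list_perm_map:
  assumes "\<sigma> permutes {..<length xs}"
  shows "list_perm (map \<sigma> xs) = \<sigma> \<circ> list_perm xs"
  using permutes_not_in[OF assms] by (auto simp: list_perm_def fun_eq_iff)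

text \<open>\<open>block_perm\<close> and \<open>sum_perm\<close> are permutations and behave as announced.\<close>

lemma block_perm_nth:
  assumes "\<sigma> permutes {..<length ks}" "i < length ks" "r < ks ! \<sigma> i"
  shows "block_perm \<sigma> ks (offset (permute_list \<sigma> ks) i + r) = offset ks (\<sigma> i) + r"
proof -
  have \<sigma>i: "\<sigma> i < length ks"
    using permutes_in_image[OF assms(1), of i] assms(2) by simp
  have len: "map length (permute_list \<sigma> (blocks ks)) = permute_list \<sigma> ks"
    using assms(1) permutes_in_image[OF assms(1)]
    by (intro nth_equalityI) (auto simp: permute_list_nth nth_blocks)
  have lt: "offset (permute_list \<sigma> ks) i + r < length (concat (permute_list \<sigma> (blocks ks)))"
    unfolding length_concat len
    using assms by (intro offset_less) (auto simp: permute_list_nth)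
  have "concat (permute_list \<sigma> (blocks ks)) ! (offset (permute_list \<sigma> ks) i + r)
      = permute_list \<sigma> (blocks ks) ! i ! r"
    unfolding len[symmetric]
    using assms \<sigma>i by (intro nth_concat_offset) (auto simp: permute_list_nth nth_blocks)
  with lt show ?thesis
    using assms \<sigma>i by (simp add: block_perm_def list_perm_nth permute_list_nth nth_blocks)
qed

lemma sum_perm_nth:
  assumes "list_all2 (\<lambda>k \<sigma>. \<sigma> permutes {..<k}) ks \<sigma>s" "i < length ks" "r < ks ! i"
  shows "sum_perm ks \<sigma>s (offset ks i + r) = offset ks i + (\<sigma>s ! i) r"
proof -
  have ls: "length \<sigma>s = length ks" using assms(1) by (simp add: list_all2_lengthD)
  have p: "\<sigma>s ! i permutes {..<ks ! i}" using assms(1,2) by (rule list_all2_nthD)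
  have len: "map length (map2 permute_list \<sigma>s (blocks ks)) = ks"
    using ls by (intro nth_equalityI) (auto simp: nth_blocks)
  have lt: "offset ks i + r < length (concat (map2 permute_list \<sigma>s (blocks ks)))"
    unfolding length_concat len using assms by (intro offset_less)
  have "concat (map2 permute_list \<sigma>s (blocks ks)) ! (offset ks i + r)
      = map2 permute_list \<sigma>s (blocks ks) ! i ! r"
    using assms ls nth_concat_offset[of i "map2 permute_list \<sigma>s (blocks ks)" r]
    unfolding len by (auto simp: nth_blocks)
  also have "\<dots> = offset ks i + (\<sigma>s ! i) r"
    using assms ls p permutes_in_image[OF p, of r]
    by (auto simp: nth_blocks permute_list_nth)
  finally show ?thesis using lt by (simp add: sum_perm_def list_perm_nth)
qed

lemma mset_upt_perm:
  assumes "mset xs = mset [0..<n]"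
  shows "distinct xs" "set xs = {..<n}" "length xs = n"
  using mset_eq_imp_distinct_iff[OF assms] mset_eq_setD[OF assms] mset_eq_length[OF assms]
  by (auto simp: atLeast0LessThan)

lemma mset_concat_cong:
  "map mset xss = map mset yss \<Longrightarrow> mset (concat xss) = mset (concat yss)"
  by (metis map_map mset_concat sum_mset_sum_list mset_map)

lemma mset_concat_perm: "mset xss = mset yss \<Longrightarrow> mset (concat xss) = mset (concat yss)"
  by (metis mset_concat mset_map sum_mset_sum_list)

lemma block_perm_permutes:
  assumes "\<sigma> permutes {..<length ks}"
  shows "block_perm \<sigma> ks permutes {..<sum_list ks}"
proof -
  have "mset (permute_list \<sigma> (blocks ks)) = mset (blocks ks)"
    using assms by (intro mset_permute_list) simp
  from mset_concat_perm[OF this]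
  show ?thesis unfolding block_perm_def concat_blocks
    by (intro list_perm_permutes mset_upt_perm)
qed

lemma sum_perm_permutes:
  assumes "list_all2 (\<lambda>k \<sigma>. \<sigma> permutes {..<k}) ks \<sigma>s"
  shows "sum_perm ks \<sigma>s permutes {..<sum_list ks}"
proof -
  have ls: "length \<sigma>s = length ks" using assms by (simp add: list_all2_lengthD)
  have "map mset (map2 permute_list \<sigma>s (blocks ks)) = map mset (blocks ks)"
    using assms ls
    by (intro nth_equalityI) (auto simp: nth_blocks dest: list_all2_nthD intro!: mset_permute_list)
  from mset_concat_cong[OF this]
  show ?thesis unfolding sum_perm_def concat_blocks
    by (intro list_perm_permutes mset_upt_perm)
qed


section \<open>The universal property of the free symmetric operad\<close>

lemma subst_subst: "subst s (subst r t) = subst (\<lambda>i. subst s (r i)) t"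
  by (induction t) auto

lemma subst_cong: "(\<And>i. i \<in> set (vars t) \<Longrightarrow> s i = s' i) \<Longrightarrow> subst s t = subst s' t"
  by (induction t) auto

lemma subst_Var [simp]: "subst Var t = t"
  by (induction t) (auto simp: map_idI)

lemma vars_subst: "vars (subst s t) = concat (map (\<lambda>i. vars (s i)) (vars t))"
proof (induction t)
  case (Op f ts)
  then show ?case by (induction ts) auto
qed simp

lemma vars_rename [simp]: "vars (rename r t) = map r (vars t)"
  by (simp add: vars_subst comp_def) 

lemma subst_terms: "\<lbrakk>t \<in> terms \<Phi>; \<And>i. i \<in> set (vars t) \<Longrightarrow> s i \<in> terms \<Phi>\<rbrakk> \<Longrightarrow> subst s t \<in> terms \<Phi>"
proof (induction t rule: terms.induct)
  case (Op f ts)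
  show ?case
    unfolding subst.simps by (rule terms.Op) (use Op in \<open>auto simp: Bex_def\<close>)
qed simp

lemma terms_Op_iff: "Op f ts \<in> terms \<Phi> \<longleftrightarrow> f \<in> \<Phi> (length ts) \<and> set ts \<subseteq> terms \<Phi>"
  by (auto intro: terms.intros elim: terms.cases)

lemma free_Carr: "t \<in> Carr (free_operad \<Phi>) n \<longleftrightarrow> t \<in> terms \<Phi> \<and> distinct (vars t) \<and> set (vars t) = {..<n}"
  by (simp add: free_operad_def)

lemma length_vars: "t \<in> Carr (free_operad \<Phi>) n \<Longrightarrow> length (vars t) = n"
  unfolding free_Carr by (metis card_lessThan distinct_card)

lemma free_Comp: "Comp (free_operad \<Phi>) ks t us = subst (\<lambda>i. rename (\<lambda>j. offset ks i + j) (us ! i)) t"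
  by (simp add: free_operad_def)

lemma free_Act: "Act (free_operad \<Phi>) n \<sigma> t = rename \<sigma> t"
  by (simp add: free_operad_def)

lemma free_Unit: "Unit (free_operad \<Phi>) = Var 0"
  by (simp add: free_operad_def)

lemma list_perm_vars:
  "t \<in> Carr (free_operad \<Phi>) n \<Longrightarrow> list_perm (vars t) permutes {..<n}"
  by (auto simp: free_Carr intro: list_perm_permutes)

lemma vars_free_Comp:
  assumes "t \<in> Carr (free_operad \<Phi>) (length ks)" "args (Carr (free_operad \<Phi>)) ks us"
  shows "list_perm (vars (Comp (free_operad \<Phi>) ks t us)) =
    sum_perm ks (map (list_perm \<circ> vars) us) \<circ> block_perm (list_perm (vars t)) ks"
    and "Comp (free_operad \<Phi>) ks t us \<in> Carr (free_operad \<Phi>) (sum_list ks)"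
proof -
  let ?\<pi> = "list_perm (vars t)" and ?\<pi>s = "map (list_perm \<circ> vars) us"
  let ?B = "permute_list ?\<pi> (blocks ks)"
  have \<pi>: "?\<pi> permutes {..<length ks}" using assms by (rule_tac list_perm_vars)
  have lu: "length us = length ks" using assms by (simp add: list_all2_lengthD)
  have u: "us ! i \<in> Carr (free_operad \<Phi>) (ks ! i)" if "i < length ks" for i
    using assms(2) that by (rule list_all2_nthD)
  have \<pi>s: "list_all2 (\<lambda>k \<sigma>. \<sigma> permutes {..<k}) ks ?\<pi>s"
    using u lu by (auto simp: list_all2_conv_all_nth intro: list_perm_vars)
  have lt: "length (vars t) = length ks" using assms by (simp add: length_vars)
  note bp = block_perm_permutes[OF \<pi>] and sp = sum_perm_permutes[OF \<pi>s]
  have v: "map (\<lambda>i. map ((+) (offset ks i)) (vars (us ! i))) (vars t) = map (map (sum_perm ks ?\<pi>s)) ?B"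
  proof (rule nth_equalityI)
    fix j assume "j < length (map (\<lambda>i. map ((+) (offset ks i)) (vars (us ! i))) (vars t))"
    then have j: "j < length ks" using lt by simp
    then have \<pi>j: "?\<pi> j < length ks" using permutes_in_image[OF \<pi>, of j] by simp
    have e: "vars t ! j = ?\<pi> j" using j lt by (simp add: list_perm_nth)
    have "map ((+) (offset ks (?\<pi> j))) (vars (us ! ?\<pi> j)) = map (sum_perm ks ?\<pi>s) (blocks ks ! ?\<pi> j)"
      using \<pi>j length_vars[OF u[OF \<pi>j]]
      by (intro nth_equalityI)
         (auto simp: nth_blocks sum_perm_nth[OF \<pi>s] lu list_perm_nth)
    then show "map (\<lambda>i. map ((+) (offset ks i)) (vars (us ! i))) (vars t) ! j = map (map (sum_perm ks ?\<pi>s)) ?B ! j"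
      using j lt e \<pi> by (simp add: permute_list_nth)
  qed (simp add: lt)
  have "vars (Comp (free_operad \<Phi>) ks t us) = concat (map (\<lambda>i. map ((+) (offset ks i)) (vars (us ! i))) (vars t))"
    by (simp add: free_Comp vars_subst comp_def)
  then have V: "vars (Comp (free_operad \<Phi>) ks t us) = map (sum_perm ks ?\<pi>s) (concat ?B)"
    by (simp only: v map_concat)
  have "mset ?B = mset (blocks ks)" using \<pi> by (intro mset_permute_list) simp
  from mset_concat_perm[OF this] have M: "mset (concat ?B) = mset [0..<sum_list ks]"
    by (simp add: concat_blocks)
  then have D: "distinct (concat ?B)" "set (concat ?B) = {..<sum_list ks}" "length (concat ?B) = sum_list ks"
    using mset_upt_perm[OF M] by auto
  show "list_perm (vars (Comp (free_operad \<Phi>) ks t us)) = sum_perm ks ?\<pi>s \<circ> block_perm ?\<pi> ks"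
    unfolding V block_perm_def using sp D(3) by (intro list_perm_map) simp
  have "Comp (free_operad \<Phi>) ks t us \<in> terms \<Phi>"
    using assms(1) u
    by (auto simp: free_Comp free_Carr intro!: subst_terms terms.Var)
  moreover have "distinct (vars (Comp (free_operad \<Phi>) ks t us))"
    unfolding V using D(1) permutes_inj_on[OF sp] by (simp add: distinct_map)
  moreover have "set (vars (Comp (free_operad \<Phi>) ks t us)) = {..<sum_list ks}"
    unfolding V using D(2) permutes_image[OF sp] by (metis list.set_map)
  ultimately show "Comp (free_operad \<Phi>) ks t us \<in> Carr (free_operad \<Phi>) (sum_list ks)"
    by (simp add: free_Carr)
qed

lemma subst_subst_cong:
  "(\<And>i. i \<in> set (vars t) \<Longrightarrow> subst s (r i) = s' i) \<Longrightarrow> subst s (subst r t) = subst s' t"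
  by (simp add: subst_subst cong: subst_cong)

lemma subst_subst_cong2:
  "(\<And>i. i \<in> set (vars t) \<Longrightarrow> subst s (r i) = subst s' (r' i)) \<Longrightarrow>
   subst s (subst r t) = subst s' (subst r' t)"
  by (simp add: subst_subst cong: subst_cong)

lemma free_operad_symmetric_operad: "symmetric_operad (free_operad \<Phi>)"
proof
  fix p ks qs
  assume "p \<in> Carr (free_operad \<Phi>) (length ks)" "args (Carr (free_operad \<Phi>)) ks qs"
  then show "Comp (free_operad \<Phi>) ks p qs \<in> Carr (free_operad \<Phi>) (sum_list ks)"
    by (rule vars_free_Comp)
next
  show "Unit (free_operad \<Phi>) \<in> Carr (free_operad \<Phi>) 1"
    by (auto simp: free_Carr free_Unit intro: terms.intros)
next
  fix \<sigma> n p assume "\<sigma> permutes {..<n}" "p \<in> Carr (free_operad \<Phi>) n"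
  then show "Act (free_operad \<Phi>) n \<sigma> p \<in> Carr (free_operad \<Phi>) n"
    by (auto simp: free_Carr free_Act distinct_map permutes_image permutes_inj_on
        intro!: subst_terms terms.Var)
next
  fix p :: "'a tm" and kss qs rss
  assume p: "p \<in> Carr (free_operad \<Phi>) (length kss)"
    and qs: "args (Carr (free_operad \<Phi>)) (map length kss) qs"
    and rss: "list_all2 (args (Carr (free_operad \<Phi>))) kss rss"
  have len: "length qs = length kss" "length rss = length kss"
    using qs rss by (auto dest: list_all2_lengthD)
  have lens: "map length rss = map length kss"
    using len list_all2_lengthD[OF list_all2_nthD[OF rss]] by (intro nth_equalityI) auto
  have q: "qs ! i \<in> Carr (free_operad \<Phi>) (length (kss ! i))" if "i < length kss" for i
    using list_all2_nthD2[OF qs, of i] that len by simp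
  show "Comp (free_operad \<Phi>) (concat kss) (Comp (free_operad \<Phi>) (map length kss) p qs) (concat rss) =
     Comp (free_operad \<Phi>) (map sum_list kss) p
       (map2 (\<lambda>ks (q, rs). Comp (free_operad \<Phi>) ks q rs) kss (zip qs rss))"
    unfolding free_Comp
  proof (rule subst_subst_cong)
    fix i assume "i \<in> set (vars p)"
    then have i: "i < length kss" using p by (simp add: free_Carr)
    have n: "concat rss ! (offset (map length kss) i + j) = rss ! i ! j"
      "offset (concat kss) (offset (map length kss) i + j) =
       offset (map sum_list kss) i + offset (kss ! i) j"
      if "j \<in> set (vars (qs ! i))" for j
    proof -
      have "j < length (kss ! i)" using that q[OF i] by (simp add: free_Carr)
      moreover have "length (rss ! i) = length (kss ! i)"
        using lens i len by (metis nth_map)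
      ultimately show "concat rss ! (offset (map length kss) i + j) = rss ! i ! j"
        "offset (concat kss) (offset (map length kss) i + j) =
         offset (map sum_list kss) i + offset (kss ! i) j"
        using nth_concat_offset[of i rss j] i offset_concat[of i kss j]
        unfolding lens len by auto
    qed
    show "subst (\<lambda>i. rename (\<lambda>j. offset (concat kss) i + j) (concat rss ! i))
         (rename (\<lambda>j. offset (map length kss) i + j) (qs ! i)) =
       rename (\<lambda>j. offset (map sum_list kss) i + j)
        (map2 (\<lambda>ks (q, rs). subst (\<lambda>i. rename (\<lambda>j. offset ks i + j) (rs ! i)) q) kss (zip qs rss) ! i)"
      using i len by (auto simp: subst_subst n add.assoc intro!: subst_cong)
  qed
next
  fix p :: "'a tm" and n assume "p \<in> Carr (free_operad \<Phi>) n"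
  show "Comp (free_operad \<Phi>) [n] (Unit (free_operad \<Phi>)) [p] = p"
    by (simp add: free_Comp free_Unit)
next
  fix p :: "'a tm" and n assume p: "p \<in> Carr (free_operad \<Phi>) n"
  have "subst (\<lambda>i. rename (\<lambda>j. offset (replicate n 1) i + j) (replicate n (Var 0) ! i)) p
    = subst Var p"
  proof (rule subst_cong)
    fix i assume "i \<in> set (vars p)"
    then show "rename (\<lambda>j. offset (replicate n 1) i + j) (replicate n (Var 0) ! i) = Var i"
      using p by (auto simp: free_Carr offset_def sum_list_replicate)
  qed
  then show "Comp (free_operad \<Phi>) (replicate n 1) p (replicate n (Unit (free_operad \<Phi>))) = p"
    by (simp add: free_Comp free_Unit)
next
  fix p :: "'a tm" and n assume "p \<in> Carr (free_operad \<Phi>) n"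
  show "Act (free_operad \<Phi>) n id p = p" by (simp add: free_Act)
next
  fix p :: "'a tm" and n \<sigma> \<tau>
  show "Act (free_operad \<Phi>) n (\<sigma> \<circ> \<tau>) p = Act (free_operad \<Phi>) n \<sigma> (Act (free_operad \<Phi>) n \<tau> p)"
    by (simp add: free_Act subst_subst)
next
  fix p :: "'a tm" and ks \<sigma> qs
  assume \<sigma>: "\<sigma> permutes {..<length ks}" and p: "p \<in> Carr (free_operad \<Phi>) (length ks)"
    and qs: "args (Carr (free_operad \<Phi>)) ks qs"
  have len: "length qs = length ks" using qs by (auto dest: list_all2_lengthD)
  show "Comp (free_operad \<Phi>) ks (Act (free_operad \<Phi>) (length ks) \<sigma> p) qs =
    Act (free_operad \<Phi>) (sum_list ks) (block_perm \<sigma> ks)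
      (Comp (free_operad \<Phi>) (permute_list \<sigma> ks) p (permute_list \<sigma> qs))"
    unfolding free_Comp free_Act
  proof (rule subst_subst_cong2)
    fix i assume "i \<in> set (vars p)"
    then have i: "i < length ks" using p by (simp add: free_Carr)
    then have \<sigma>i: "\<sigma> i < length ks" using permutes_in_image[OF \<sigma>, of i] by simp
    then have q: "qs ! \<sigma> i \<in> Carr (free_operad \<Phi>) (ks ! \<sigma> i)"
      using qs by (rule_tac list_all2_nthD)
    show "subst (\<lambda>i. rename (\<lambda>j. offset ks i + j) (qs ! i)) (Var (\<sigma> i)) =
      rename (block_perm \<sigma> ks) (rename (\<lambda>j. offset (permute_list \<sigma> ks) i + j) (permute_list \<sigma> qs ! i))"
    proof -
      have pq: "permute_list \<sigma> qs ! i = qs ! \<sigma> i"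
        using i len \<sigma> by (simp add: permute_list_def)
      show ?thesis
        unfolding pq subst_subst subst.simps
        by (rule subst_cong) (use q in \<open>simp add: block_perm_nth[OF \<sigma> i] free_Carr\<close>)
    qed
  qed
next
  fix p :: "'a tm" and ks \<sigma>s qs
  assume \<sigma>s: "list_all2 (\<lambda>k \<sigma>. \<sigma> permutes {..<k}) ks \<sigma>s"
    and p: "p \<in> Carr (free_operad \<Phi>) (length ks)" and qs: "args (Carr (free_operad \<Phi>)) ks qs"
  have len: "length qs = length ks" "length \<sigma>s = length ks"
    using qs \<sigma>s by (auto dest: list_all2_lengthD)
  show "Comp (free_operad \<Phi>) ks p (map2 (\<lambda>k (\<sigma>, q). Act (free_operad \<Phi>) k \<sigma> q) ks (zip \<sigma>s qs)) =
    Act (free_operad \<Phi>) (sum_list ks) (sum_perm ks \<sigma>s) (Comp (free_operad \<Phi>) ks p qs)"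
    unfolding free_Comp free_Act
  proof (rule subst_subst_cong[symmetric], rule sym)
    fix i assume "i \<in> set (vars p)"
    then have i: "i < length ks" using p by (simp add: free_Carr)
    then have q: "qs ! i \<in> Carr (free_operad \<Phi>) (ks ! i)"
      using qs i by (rule_tac list_all2_nthD)
    show "rename (\<lambda>j. offset ks i + j) (map2 (\<lambda>k (\<sigma>, q). rename \<sigma> q) ks (zip \<sigma>s qs) ! i) =
      rename (sum_perm ks \<sigma>s) (rename (\<lambda>j. offset ks i + j) (qs ! i))"
    proof -
      have pq: "map2 (\<lambda>k (\<sigma>, q). rename \<sigma> q) ks (zip \<sigma>s qs) ! i = rename (\<sigma>s ! i) (qs ! i)"
        using i len by simp
      show ?thesis
        unfolding pq subst_subst subst.simps
        by (rule subst_cong) (use q in \<open>simp add: sum_perm_nth[OF \<sigma>s i] free_Carr\<close>)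
    qed
  qed
qed

lemma gen_closed: "f \<in> \<Phi> n \<Longrightarrow> gen n f \<in> Carr (free_operad \<Phi>) n"
  by (auto simp: gen_def free_Carr terms_Op_iff terms.Var comp_def)

context symmetric_operad
begin

lemma plain_eval_closed:
  assumes h: "\<forall>n. \<forall>f\<in>\<Phi> n. h n f \<in> Carr P n"
  shows "t \<in> terms \<Phi> \<Longrightarrow> plain_eval P h t \<in> Carr P (length (vars t))"
proof (induction t rule: terms.induct)
  case (Var i)
  then show ?case using unit_closed by simp
next
  case (Op f ts)
  have "Comp P (map (length \<circ> vars) ts) (h (length ts) f) (map (plain_eval P h) ts)
    \<in> Carr P (sum_list (map (length \<circ> vars) ts))"
    using Op h by (intro comp_closed) (auto simp: list_all2_conv_all_nth)
  then show ?case by (simp add: length_concat comp_def)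
qed

lemma plain_eval_subst:
  assumes h: "\<forall>n. \<forall>f\<in>\<Phi> n. h n f \<in> Carr P n"
  shows "\<lbrakk>t \<in> terms \<Phi>; \<And>i. i \<in> set (vars t) \<Longrightarrow> s i \<in> terms \<Phi>\<rbrakk> \<Longrightarrow>
    plain_eval P h (subst s t) =
    Comp P (map (\<lambda>i. length (vars (s i))) (vars t)) (plain_eval P h t)
      (map (\<lambda>i. plain_eval P h (s i)) (vars t))"
proof (induction t rule: terms.induct)
  case (Var i)
  then show ?case using plain_eval_closed[OF h] by (simp add: unit_left)
next
  case (Op f ts)
  let ?kss = "map (\<lambda>t. map (\<lambda>i. length (vars (s i))) (vars t)) ts"
  let ?rss = "map (\<lambda>t. map (\<lambda>i. plain_eval P h (s i)) (vars t)) ts"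
  let ?qs = "map (plain_eval P h) ts"
  have sv: "s i \<in> terms \<Phi>" if "t \<in> set ts" "i \<in> set (vars t)" for t i
    using that Op.prems by auto
  have q: "plain_eval P h t \<in> Carr P (length (vars t))" if "t \<in> set ts" for t
    using that Op by (intro plain_eval_closed[OF h]) auto
  have "Comp P (concat ?kss) (Comp P (map length ?kss) (h (length ts) f) ?qs) (concat ?rss) =
    Comp P (map sum_list ?kss) (h (length ts) f)
      (map2 (\<lambda>ks (q, rs). Comp P ks q rs) ?kss (zip ?qs ?rss))"
  proof (rule comp_assoc)
    show "h (length ts) f \<in> Carr P (length ?kss)" using Op h by simp
    show "args (Carr P) (map length ?kss) ?qs"
      using q by (auto simp: list_all2_conv_all_nth)
    show "list_all2 (args (Carr P)) ?kss ?rss"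
      using plain_eval_closed[OF h sv[OF nth_mem nth_mem]] by (auto simp: list_all2_conv_all_nth)
  qed
  moreover have "map2 (\<lambda>ks (q, rs). Comp P ks q rs) ?kss (zip ?qs ?rss) =
    map (\<lambda>t. plain_eval P h (subst s t)) ts"
    using Op.IH sv by (intro nth_equalityI) auto
  moreover have "map sum_list ?kss = map (\<lambda>t. length (vars (subst s t))) ts"
    by (auto simp: vars_subst length_concat comp_def)
  moreover have "map length ?kss = map (\<lambda>t. length (vars t)) ts"
    by auto
  ultimately show ?case
    by (simp add: map_concat comp_def del: map_eq_conv)
qed

lemma plain_eval_rename:
  assumes h: "\<forall>n. \<forall>f\<in>\<Phi> n. h n f \<in> Carr P n" and t: "t \<in> terms \<Phi>"
  shows "plain_eval P h (rename r t) = plain_eval P h t"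
  using plain_eval_subst[OF h t, of "\<lambda>i. Var (r i)"] plain_eval_closed[OF h t]
  by (simp add: terms.Var map_replicate_const unit_right[simplified])

lemma free_lift_hom:
  assumes h: "\<forall>n. \<forall>f\<in>\<Phi> n. h n f \<in> Carr P n"
  shows "operad_hom (free_operad \<Phi>) P (free_lift P h)"
proof -
  interpret F: symmetric_operad "free_operad \<Phi>" by (rule free_operad_symmetric_operad)
  have pe: "plain_eval P h t \<in> Carr P n" if "t \<in> Carr (free_operad \<Phi>) n" for t n
    using that plain_eval_closed[OF h, of t] length_vars[OF that] by (simp add: free_Carr)
  show ?thesis
  proof
    fix p :: "'b tm" and n assume "p \<in> Carr (free_operad \<Phi>) n"
    then show "free_lift P h n p \<in> Carr P n"
      unfolding free_lift_def by (intro act_closed list_perm_vars pe)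
  next
    fix p :: "'b tm" and ks qs
    assume p: "p \<in> Carr (free_operad \<Phi>) (length ks)" and qs: "args (Carr (free_operad \<Phi>)) ks qs"
    let ?\<pi> = "list_perm (vars p)" and ?\<pi>s = "map (list_perm \<circ> vars) qs"
    let ?e = "plain_eval P h"
    have len: "length qs = length ks" using qs by (auto dest: list_all2_lengthD)
    have q: "qs ! i \<in> Carr (free_operad \<Phi>) (ks ! i)" if "i < length ks" for i
      using qs that by (rule list_all2_nthD)
    have \<pi>: "?\<pi> permutes {..<length ks}" using p by (rule list_perm_vars)
    have \<pi>s: "list_all2 (\<lambda>k \<sigma>. \<sigma> permutes {..<k}) ks ?\<pi>s"
      using q len by (auto simp: list_all2_conv_all_nth intro: list_perm_vars)
    have lp: "length (vars p) = length ks" using p by (rule length_vars)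
    have vp: "i \<in> set (vars p) \<longleftrightarrow> i < length ks" for i using p by (auto simp: free_Carr)
    have eqs: "args (Carr P) ks (map ?e qs)"
      using q len by (auto simp: list_all2_conv_all_nth intro: pe)
    have perm: "permute_list ?\<pi> xs = map ((!) xs) (vars p)" if "length xs = length ks" for xs :: "'c list"
      using that lp by (intro nth_equalityI) (auto simp: permute_list_def list_perm_nth)
    have T: "qs ! i \<in> terms \<Phi>" if "i \<in> set (vars p)" for i
      using q that by (simp add: vp free_Carr)
    have "?e (Comp (free_operad \<Phi>) ks p qs) =
      Comp P (map (\<lambda>i. length (vars (rename (\<lambda>j. offset ks i + j) (qs ! i)))) (vars p)) (?e p)
        (map (\<lambda>i. ?e (rename (\<lambda>j. offset ks i + j) (qs ! i))) (vars p))"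
      unfolding free_Comp using p T
      by (intro plain_eval_subst[OF h]) (auto simp: free_Carr intro!: subst_terms terms.Var)
    also have "map (\<lambda>i. ?e (rename (\<lambda>j. offset ks i + j) (qs ! i))) (vars p) =
      map (\<lambda>i. ?e (qs ! i)) (vars p)"
      using T by (intro map_cong refl plain_eval_rename[OF h]) simp_all
    also have "map (\<lambda>i. length (vars (rename (\<lambda>j. offset ks i + j) (qs ! i)))) (vars p) =
      map (\<lambda>i. length (vars (qs ! i))) (vars p)"
      by simp
    also have "map (\<lambda>i. length (vars (qs ! i))) (vars p) = permute_list ?\<pi> ks"
      using perm[of ks] by (auto simp: vp length_vars[OF q])
    also have "map (\<lambda>i. ?e (qs ! i)) (vars p) = permute_list ?\<pi> (map ?e qs)"
      by (subst perm) (auto simp: vp len)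
    finally have e: "?e (Comp (free_operad \<Phi>) ks p qs) =
      Comp P (permute_list ?\<pi> ks) (?e p) (permute_list ?\<pi> (map ?e qs))" .
    have cl: "Comp P (permute_list ?\<pi> ks) (?e p) (permute_list ?\<pi> (map ?e qs)) \<in> Carr P (sum_list ks)"
      using pe[OF F.comp_closed[OF p qs]] e by simp
    have "map2 (free_lift P h) ks qs = map2 (\<lambda>k (\<sigma>, q). Act P k \<sigma> q) ks (zip ?\<pi>s (map ?e qs))"
      using len by (intro nth_equalityI) (auto simp: free_lift_def)
    then have "Comp P ks (free_lift P h (length ks) p) (map2 (free_lift P h) ks qs) =
      Act P (sum_list ks) (sum_perm ks ?\<pi>s) (Comp P ks (Act P (length ks) ?\<pi> (?e p)) (map ?e qs))"
      using comp_act_inner[OF \<pi>s _ eqs] act_closed[OF \<pi> pe[OF p]] by (simp add: free_lift_def)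
    also have "\<dots> = Act P (sum_list ks) (sum_perm ks ?\<pi>s \<circ> block_perm ?\<pi> ks)
      (?e (Comp (free_operad \<Phi>) ks p qs))"
      unfolding e comp_act_outer[OF \<pi> pe[OF p] eqs]
      using act_act[OF sum_perm_permutes[OF \<pi>s] block_perm_permutes[OF \<pi>] cl] by simp
    also have "\<dots> = free_lift P h (sum_list ks) (Comp (free_operad \<Phi>) ks p qs)"
      by (simp only: free_lift_def vars_free_Comp(1)[OF p qs])
    finally show "free_lift P h (sum_list ks) (Comp (free_operad \<Phi>) ks p qs) =
      Comp P ks (free_lift P h (length ks) p) (map2 (free_lift P h) ks qs)" by simp
  next
    show "free_lift P h 1 (Unit (free_operad \<Phi>)) = Unit P"
      using act_id[OF unit_closed] list_perm_upt[of 1]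
      by (simp add: free_lift_def free_Unit)
  next
    fix \<sigma> n and p :: "'b tm"
    assume \<sigma>: "\<sigma> permutes {..<n}" and p: "p \<in> Carr (free_operad \<Phi>) n"
    have "list_perm (map \<sigma> (vars p)) = \<sigma> \<circ> list_perm (vars p)"
      using \<sigma> length_vars[OF p] by (intro list_perm_map) simp
    moreover have "p \<in> terms \<Phi>" using p by (simp add: free_Carr)
    ultimately show "free_lift P h n (Act (free_operad \<Phi>) n \<sigma> p) = Act P n \<sigma> (free_lift P h n p)"
      using act_act[OF \<sigma> list_perm_vars[OF p] pe[OF p]]
      by (simp add: free_lift_def free_Act plain_eval_rename[OF h])
  qed
qed

lemma free_lift_gen:
  assumes "h n f \<in> Carr P n"
  shows "free_lift P h n (gen n f) = h n f"
  using unit_right[OF assms] act_id[OF assms] 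
  by (simp add: free_lift_def gen_def comp_def map_replicate_const)

end

text \<open>Every linear term is a renaming of its plain form, built by composition from generators.\<close>

primrec plain_form :: "'f tm \<Rightarrow> 'f tm" where
  "plain_form (Var i) = Var 0"
| "plain_form (Op f ts) = Comp (free_operad (\<lambda>_. UNIV)) (map (length \<circ> vars) ts) (gen (length ts) f) (map plain_form ts)"

lemma free_Comp_eq: "Comp (free_operad \<Phi>) = Comp (free_operad \<Psi>)"
  by (simp add: free_operad_def)

lemma rename_plain_form:
  "rename (\<lambda>i. vars t ! i) (plain_form t) = t \<and> vars (plain_form t) = [0..<length (vars t)]"
proof (induction t)
  case (Op f ts)
  let ?ks = "map (length \<circ> vars) ts"
  have pf: "plain_form (Op f ts) = Op f (map (\<lambda>i. rename (\<lambda>j. offset ?ks i + j) (plain_form (ts ! i))) [0..<length ts])"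
    by (auto simp: free_Comp gen_def comp_def)
  have "rename (\<lambda>i. vars (Op f ts) ! i) (plain_form (Op f ts)) = Op f ts"
  proof -
    have "rename (\<lambda>i. vars (Op f ts) ! i) (rename (\<lambda>j. offset ?ks i + j) (plain_form (ts ! i))) = ts ! i"
      if "i < length ts" for i
    proof -
      have IH: "rename ((!) (vars (ts ! i))) (plain_form (ts ! i)) = ts ! i"
        "vars (plain_form (ts ! i)) = [0..<length (vars (ts ! i))]"
        using Op that by auto
      have "rename (\<lambda>i. vars (Op f ts) ! i) (rename (\<lambda>j. offset ?ks i + j) (plain_form (ts ! i))) =
        rename ((!) (vars (ts ! i))) (plain_form (ts ! i))"
        unfolding subst_subst
        using that IH(2) nth_concat_offset[of i "map vars ts"]
        by (intro subst_cong) (simp add: comp_def)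
      with IH show ?thesis by simp
    qed
    then show ?thesis unfolding pf by (auto intro: nth_equalityI)
  qed
  moreover have "vars (plain_form (Op f ts)) = [0..<length (vars (Op f ts))]"
  proof -
    have "vars (plain_form (Op f ts)) = concat (map (\<lambda>i. map ((+) (offset ?ks i)) (vars (plain_form (ts ! i)))) [0..<length ts])"
      unfolding pf by (simp add: comp_def)
    also have "\<dots> = concat (blocks ?ks)"
      using Op by (intro arg_cong[where f = concat] nth_equalityI) (auto simp: nth_blocks)
    finally show ?thesis by (simp add: concat_blocks length_concat comp_def)
  qed
  ultimately show ?case by blast
qed simp

lemma plain_form_closed:
  assumes "t \<in> terms \<Phi>"
  shows "plain_form t \<in> Carr (free_operad \<Phi>) (length (vars t))"
proof -
  have "plain_form t \<in> terms \<Phi>" using assms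
    by (induction t rule: terms.induct)
       (auto simp: free_Comp gen_def terms_Op_iff intro!: terms.Var subst_terms)
  then show ?thesis using rename_plain_form[of t] by (auto simp: free_Carr)
qed

lemma free_hom_unique:
  assumes "operad_hom (free_operad \<Phi>) P g" "operad_hom (free_operad \<Phi>) P g'"
    and eq: "\<And>n f. f \<in> \<Phi> n \<Longrightarrow> g n (gen n f) = g' n (gen n f)"
    and t: "t \<in> Carr (free_operad \<Phi>) n"
  shows "g n t = g' n t"
proof -
  interpret g: operad_hom "free_operad \<Phi>" P g by fact
  interpret g': operad_hom "free_operad \<Phi>" P g' by fact
  have pf: "g (length (vars t)) (plain_form t) = g' (length (vars t)) (plain_form t)"
    if "t \<in> terms \<Phi>" for t
    using that
  proof (induction t rule: terms.induct)
    case (Var i)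
    then show ?case using g.hom_unit g'.hom_unit by (simp add: free_Unit)
  next
    case (Op f ts)
    let ?ks = "map (length \<circ> vars) ts"
    have p: "plain_form (Op f ts) = Comp (free_operad \<Phi>) ?ks (gen (length ts) f) (map plain_form ts)"
      by (simp add: free_Comp)
    have n: "length (vars (Op f ts)) = sum_list ?ks" by (simp add: length_concat comp_def)
    have a: "args (Carr (free_operad \<Phi>)) ?ks (map plain_form ts)"
      using Op by (auto simp: list_all2_conv_all_nth intro: plain_form_closed)
    have c: "gen (length ts) f \<in> Carr (free_operad \<Phi>) (length ?ks)"
      using gen_closed Op by simp
    have "map2 g ?ks (map plain_form ts) = map2 g' ?ks (map plain_form ts)"
      using Op by (intro nth_equalityI) auto
    then show ?case
      unfolding p n g.hom_comp[OF c a] g'.hom_comp[OF c a] using eq Op by (simp del: map_eq_conv)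
  qed
  have n: "length (vars t) = n" using t by (rule length_vars)
  have T: "t \<in> terms \<Phi>" using t by (simp add: free_Carr)
  have "rename (list_perm (vars t)) (plain_form t) = rename (\<lambda>i. vars t ! i) (plain_form t)"
    using rename_plain_form[of t] by (intro subst_cong) (auto simp: list_perm_nth)
  then have "t = Act (free_operad \<Phi>) n (list_perm (vars t)) (plain_form t)"
    using rename_plain_form[of t] by (simp add: free_Act)
  then show ?thesis
    using pf[OF T] plain_form_closed[OF T] list_perm_vars[OF t] n
      g.hom_act[of "list_perm (vars t)" n "plain_form t"] g'.hom_act[of "list_perm (vars t)" n "plain_form t"]
    by simp
qed

theorem free_operad_universal:
  fixes h :: "nat \<Rightarrow> 'f \<Rightarrow> 'a"
  assumes "symmetric_operad P" and "\<forall>n. \<forall>f\<in>\<Phi> n. h n f \<in> Carr P n"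
  shows "operad_hom (free_operad \<Phi>) P (free_lift P h)"
    and "\<And>n f. f \<in> \<Phi> n \<Longrightarrow> free_lift P h n (gen n f) = h n f"
    and "\<And>g n t. \<lbrakk>operad_hom (free_operad \<Phi>) P g; \<And>n f. f \<in> \<Phi> n \<Longrightarrow> g n (gen n f) = h n f;
      t \<in> Carr (free_operad \<Phi>) n\<rbrakk> \<Longrightarrow> g n t = free_lift P h n t"
proof -
  interpret symmetric_operad P by fact
  show 1: "operad_hom (free_operad \<Phi>) P (free_lift P h)" using assms(2) by (rule free_lift_hom)
  show 2: "free_lift P h n (gen n f) = h n f" if "f \<in> \<Phi> n" for n f
    using assms(2) that by (intro free_lift_gen) auto
  show "g n t = free_lift P h n t"
    if "operad_hom (free_operad \<Phi>) P g" "\<And>n f. f \<in> \<Phi> n \<Longrightarrow> g n (gen n f) = h n f"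
      "t \<in> Carr (free_operad \<Phi>) n" for g n t
    using free_hom_unique[OF that(1) 1 _ that(3)] that(2) 2 by simp
qed

lemma counit_hom:
  assumes "symmetric_operad P"
  shows "operad_hom (free_operad (Carr P)) P (counit P)"
    and "p \<in> Carr P n \<Longrightarrow> counit P n (gen n p) = p"
proof -
  have h: "\<forall>n. \<forall>f\<in>Carr P n. f \<in> Carr P n" by blast
  show "operad_hom (free_operad (Carr P)) P (counit P)"
    unfolding counit_def using assms h by (rule free_operad_universal(1))
  show "counit P n (gen n p) = p" if "p \<in> Carr P n"
    unfolding counit_def using assms h that by (rule free_operad_universal(2))
qed


section \<open>The universal property of coequalizers\<close>

locale operad_reflection = symmetric_operad P
  for P :: "'a sym_operad" +
  fixes T :: "'b sym_operad" and d :: "nat \<Rightarrow> 'b \<Rightarrow> 'a"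
  assumes r_comp_closed:
      "\<lbrakk>p \<in> Carr T (length ks); args (Carr T) ks qs\<rbrakk> \<Longrightarrow> Comp T ks p qs \<in> Carr T (sum_list ks)"
    and r_unit_closed: "Unit T \<in> Carr T 1"
    and r_act_closed: "\<lbrakk>\<sigma> permutes {..<n}; p \<in> Carr T n\<rbrakk> \<Longrightarrow> Act T n \<sigma> p \<in> Carr T n"
    and d_closed: "p \<in> Carr T n \<Longrightarrow> d n p \<in> Carr P n"
    and d_comp:
      "\<lbrakk>p \<in> Carr T (length ks); args (Carr T) ks qs\<rbrakk> \<Longrightarrow>
       d (sum_list ks) (Comp T ks p qs) = Comp P ks (d (length ks) p) (map2 d ks qs)"
    and d_unit: "d 1 (Unit T) = Unit P"
    and d_act:
      "\<lbrakk>\<sigma> permutes {..<n}; p \<in> Carr T n\<rbrakk> \<Longrightarrow> d n (Act T n \<sigma> p) = Act P n \<sigma> (d n p)"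
begin

lemma args_d: "args (Carr T) ks qs \<Longrightarrow> args (Carr P) ks (map2 d ks qs)"
  by (auto simp: list_all2_conv_all_nth d_closed)

lemma args_concat:
  "list_all2 (args C) kss rss \<Longrightarrow> args C (concat kss) (concat rss)"
  by (induction rule: list_all2_induct) (auto intro: list_all2_appendI)

lemma map2_concat:
  "list_all2 (args C) kss rss \<Longrightarrow> map2 f (concat kss) (concat rss) = concat (map2 (map2 f) kss rss)"
  by (induction rule: list_all2_induct) (auto dest: list_all2_lengthD)

lemma inner_args:
  assumes "args (Carr T) (map length kss) qs" "list_all2 (args (Carr T)) kss rss"
  shows "args (Carr T) (map sum_list kss) (map2 (\<lambda>ks (q, rs). Comp T ks q rs) kss (zip qs rss))"
  using assms by (auto simp: list_all2_conv_all_nth intro!: r_comp_closed)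

lemma r_assoc:
  assumes p: "p \<in> Carr T (length kss)" and qs: "args (Carr T) (map length kss) qs"
    and rss: "list_all2 (args (Carr T)) kss rss"
  shows "d (sum_list (concat kss)) (Comp T (concat kss) (Comp T (map length kss) p qs) (concat rss)) =
    d (sum_list (concat kss)) (Comp T (map sum_list kss) p (map2 (\<lambda>ks (q, rs). Comp T ks q rs) kss (zip qs rss)))"
proof -
  have s: "sum_list (concat kss) = sum_list (map sum_list kss)" by (induction kss) auto
  have l: "length (concat kss) = sum_list (map length kss)" by (simp add: length_concat)
  have len: "length qs = length kss" "length rss = length kss"
    using qs rss by (auto dest: list_all2_lengthD)
  have c: "Comp T (map length kss) p qs \<in> Carr T (length (concat kss))"
    using r_comp_closed[of p "map length kss" qs] p qs by (simp add: l)
  have a: "args (Carr T) (concat kss) (concat rss)" using rss by (rule args_concat)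
  have "d (sum_list (concat kss)) (Comp T (concat kss) (Comp T (map length kss) p qs) (concat rss)) =
    Comp P (concat kss) (Comp P (map length kss) (d (length kss) p) (map2 d (map length kss) qs))
      (concat (map2 (map2 d) kss rss))"
    using d_comp[OF c a] d_comp[of p "map length kss" qs] p qs map2_concat[OF rss, of d] l by simp
  also have "\<dots> = Comp P (map sum_list kss) (d (length kss) p)
    (map2 (\<lambda>ks (q, rs). Comp P ks q rs) kss (zip (map2 d (map length kss) qs) (map2 (map2 d) kss rss)))"
  proof (rule comp_assoc)
    show "d (length kss) p \<in> Carr P (length kss)" using p by (rule d_closed)
    show "args (Carr P) (map length kss) (map2 d (map length kss) qs)" using qs by (rule args_d)
    show "list_all2 (args (Carr P)) kss (map2 (map2 d) kss rss)"
      using rss by (auto simp: list_all2_conv_all_nth d_closed)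
  qed
  also have "map2 (\<lambda>ks (q, rs). Comp P ks q rs) kss (zip (map2 d (map length kss) qs) (map2 (map2 d) kss rss)) =
    map2 d (map sum_list kss) (map2 (\<lambda>ks (q, rs). Comp T ks q rs) kss (zip qs rss))"
  proof (rule nth_equalityI)
    fix i assume "i < length (map2 (\<lambda>ks (q, rs). Comp P ks q rs) kss (zip (map2 d (map length kss) qs) (map2 (map2 d) kss rss)))"
    then have i: "i < length kss" by simp
    have "qs ! i \<in> Carr T (length (kss ! i))" "args (Carr T) (kss ! i) (rss ! i)"
      using i list_all2_nthD[OF qs, of i] list_all2_nthD[OF rss, of i] by auto
    then show "map2 (\<lambda>ks (q, rs). Comp P ks q rs) kss (zip (map2 d (map length kss) qs) (map2 (map2 d) kss rss)) ! i =
      map2 d (map sum_list kss) (map2 (\<lambda>ks (q, rs). Comp T ks q rs) kss (zip qs rss)) ! i"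
      using i len by (simp add: d_comp)
  qed (simp add: len)
  also have "Comp P (map sum_list kss) (d (length kss) p) \<dots> =
    d (sum_list (concat kss)) (Comp T (map sum_list kss) p (map2 (\<lambda>ks (q, rs). Comp T ks q rs) kss (zip qs rss)))"
    using d_comp[OF _ inner_args[OF qs rss], of p] p s by simp
  finally show ?thesis .
qed

lemma r_unit_left:
  "p \<in> Carr T n \<Longrightarrow> d n (Comp T [n] (Unit T) [p]) = d n p"
  using d_comp[of "Unit T" "[n]" "[p]"] r_unit_closed d_unit by (simp add: unit_left d_closed)

lemma r_unit_right:
  assumes "p \<in> Carr T n"
  shows "d n (Comp T (replicate n 1) p (replicate n (Unit T))) = d n p"
proof -
  have "args (Carr T) (replicate n 1) (replicate n (Unit T))"
    using r_unit_closed by (auto simp: list_all2_conv_all_nth)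
  moreover have "map2 d (replicate n 1) (replicate n (Unit T)) = replicate n (Unit P)"
    using d_unit by (intro nth_equalityI) auto
  moreover have "length (replicate n (1::nat)) = n" "sum_list (replicate n (1::nat)) = n"
    by (simp_all add: sum_list_replicate)
  ultimately show ?thesis
    using d_comp[of p "replicate n 1" "replicate n (Unit T)"] assms unit_right[OF d_closed[OF assms]]
    by (simp only:)
qed

lemma r_act_id: "p \<in> Carr T n \<Longrightarrow> d n (Act T n id p) = d n p"
  by (simp add: d_act permutes_id act_id d_closed)

lemma r_act_act:
  assumes "\<sigma> permutes {..<n}" "\<tau> permutes {..<n}" "p \<in> Carr T n"
  shows "d n (Act T n (\<sigma> \<circ> \<tau>) p) = d n (Act T n \<sigma> (Act T n \<tau> p))"
  using assms permutes_compose[OF assms(2,1)]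
  by (simp add: d_act r_act_closed act_act d_closed)

lemma permuted_args:
  assumes "\<sigma> permutes {..<length ks}" "args C ks qs"
  shows "args C (permute_list \<sigma> ks) (permute_list \<sigma> qs)"
    "map2 f (permute_list \<sigma> ks) (permute_list \<sigma> qs) = permute_list \<sigma> (map2 f ks qs)"
proof -
  have len: "length qs = length ks" using assms(2) by (simp add: list_all2_lengthD)
  have \<sigma>: "\<sigma> i < length ks" if "i < length ks" for i
    using permutes_in_image[OF assms(1), of i] that by simp
  show "args C (permute_list \<sigma> ks) (permute_list \<sigma> qs)"
    unfolding list_all2_conv_all_nth
    using len \<sigma> list_all2_nthD[OF assms(2)] by (simp add: permute_list_def)
  show "map2 f (permute_list \<sigma> ks) (permute_list \<sigma> qs) = permute_list \<sigma> (map2 f ks qs)"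
    by (rule nth_equalityI) (simp_all add: permute_list_def len \<sigma>)
qed

lemma sum_permute_list: "\<sigma> permutes {..<length ks} \<Longrightarrow> sum_list (permute_list \<sigma> ks) = sum_list (ks :: nat list)"
  by (metis mset_permute_list sum_mset_sum_list)

lemma r_outer:
  assumes \<sigma>: "\<sigma> permutes {..<length ks}" and p: "p \<in> Carr T (length ks)" and qs: "args (Carr T) ks qs"
  shows "d (sum_list ks) (Comp T ks (Act T (length ks) \<sigma> p) qs) =
    d (sum_list ks) (Act T (sum_list ks) (block_perm \<sigma> ks) (Comp T (permute_list \<sigma> ks) p (permute_list \<sigma> qs)))"
proof -
  have c: "Comp T (permute_list \<sigma> ks) p (permute_list \<sigma> qs) \<in> Carr T (sum_list ks)"
    using r_comp_closed[OF _ permuted_args(1)[OF \<sigma> qs], of p] p sum_permute_list[OF \<sigma>] by simp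
  have e: "d (sum_list ks) (Comp T (permute_list \<sigma> ks) p (permute_list \<sigma> qs)) =
    Comp P (permute_list \<sigma> ks) (d (length ks) p) (permute_list \<sigma> (map2 d ks qs))"
    using d_comp[OF _ permuted_args(1)[OF \<sigma> qs], of p] p sum_permute_list[OF \<sigma>]
      permuted_args(2)[OF \<sigma> qs, of d] by simp
  show ?thesis
    unfolding d_act[OF block_perm_permutes[OF \<sigma>] c] e d_comp[OF r_act_closed[OF \<sigma> p] qs] d_act[OF \<sigma> p]
    by (rule comp_act_outer[OF \<sigma> d_closed[OF p] args_d[OF qs]])
qed

lemma act_args:
  assumes "list_all2 (\<lambda>k \<sigma>. \<sigma> permutes {..<k}) ks \<sigma>s" "args (Carr T) ks qs"
  shows "args (Carr T) ks (map2 (\<lambda>k (\<sigma>, q). Act T k \<sigma> q) ks (zip \<sigma>s qs))"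
  using assms by (auto simp: list_all2_conv_all_nth intro!: r_act_closed)

lemma r_inner:
  assumes \<sigma>s: "list_all2 (\<lambda>k \<sigma>. \<sigma> permutes {..<k}) ks \<sigma>s"
    and p: "p \<in> Carr T (length ks)" and qs: "args (Carr T) ks qs"
  shows "d (sum_list ks) (Comp T ks p (map2 (\<lambda>k (\<sigma>, q). Act T k \<sigma> q) ks (zip \<sigma>s qs))) =
    d (sum_list ks) (Act T (sum_list ks) (sum_perm ks \<sigma>s) (Comp T ks p qs))"
proof -
  have len: "length qs = length ks" "length \<sigma>s = length ks"
    using qs \<sigma>s by (auto dest: list_all2_lengthD)
  have "map2 d ks (map2 (\<lambda>k (\<sigma>, q). Act T k \<sigma> q) ks (zip \<sigma>s qs)) =
    map2 (\<lambda>k (\<sigma>, q). Act P k \<sigma> q) ks (zip \<sigma>s (map2 d ks qs))"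
  proof (rule nth_equalityI)
    fix i assume "i < length (map2 d ks (map2 (\<lambda>k (\<sigma>, q). Act T k \<sigma> q) ks (zip \<sigma>s qs)))"
    then have i: "i < length ks" by simp
    with list_all2_nthD[OF qs, of i] list_all2_nthD[OF \<sigma>s, of i]
    show "map2 d ks (map2 (\<lambda>k (\<sigma>, q). Act T k \<sigma> q) ks (zip \<sigma>s qs)) ! i =
      map2 (\<lambda>k (\<sigma>, q). Act P k \<sigma> q) ks (zip \<sigma>s (map2 d ks qs)) ! i"
      using len by (simp add: d_act)
  qed (simp add: len)
  then show ?thesis
    unfolding d_act[OF sum_perm_permutes[OF \<sigma>s] r_comp_closed[OF p qs]] d_comp[OF p qs]
      d_comp[OF p act_args[OF \<sigma>s qs]]
    using comp_act_inner[OF \<sigma>s d_closed[OF p] args_d[OF qs]] by simp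
qed

end

lemma symmetric_operad_reflect:
  assumes "operad_reflection P T d" "operad_reflection Q T e"
    and inj: "\<And>n x y. \<lbrakk>x \<in> Carr T n; y \<in> Carr T n; d n x = d n y; e n x = e n y\<rbrakk> \<Longrightarrow> x = y"
  shows "symmetric_operad T" "operad_hom T P d"
proof -
  interpret d: operad_reflection P T d by fact
  interpret e: operad_reflection Q T e by fact
  show T: "symmetric_operad T"
  proof
    fix p kss qs rss
    assume *: "p \<in> Carr T (length kss)" "args (Carr T) (map length kss) qs"
      "list_all2 (args (Carr T)) kss rss"
    have s: "sum_list (concat kss) = sum_list (map sum_list kss)" by (induction kss) auto
    have l: "length (concat kss) = sum_list (map length kss)" by (simp add: length_concat)
    show "Comp T (concat kss) (Comp T (map length kss) p qs) (concat rss) =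
      Comp T (map sum_list kss) p (map2 (\<lambda>ks (q, rs). Comp T ks q rs) kss (zip qs rss))"
    proof (rule inj[OF _ _ d.r_assoc[OF *] e.r_assoc[OF *]])
      show "Comp T (concat kss) (Comp T (map length kss) p qs) (concat rss) \<in> Carr T (sum_list (concat kss))"
        using d.r_comp_closed[of p "map length kss" qs] *
        by (intro d.r_comp_closed d.args_concat) (simp_all add: l)
      show "Comp T (map sum_list kss) p (map2 (\<lambda>ks (q, rs). Comp T ks q rs) kss (zip qs rss))
        \<in> Carr T (sum_list (concat kss))"
        unfolding s using * by (intro d.r_comp_closed d.inner_args) simp_all
    qed
  next
    fix p n assume p: "p \<in> Carr T n"
    show "Comp T [n] (Unit T) [p] = p"
      using p d.r_comp_closed[of "Unit T" "[n]" "[p]"] d.r_unit_closed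
      by (intro inj[OF _ _ d.r_unit_left[OF p] e.r_unit_left[OF p]]) simp_all
    show "Comp T (replicate n 1) p (replicate n (Unit T)) = p"
      using p d.r_comp_closed[of p "replicate n 1" "replicate n (Unit T)"] d.r_unit_closed
      by (intro inj[OF _ _ d.r_unit_right[OF p] e.r_unit_right[OF p]])
         (simp_all add: sum_list_replicate list_all2_conv_all_nth)
    show "Act T n id p = p"
      using p d.r_act_closed[OF permutes_id p]
      by (intro inj[OF _ _ d.r_act_id[OF p] e.r_act_id[OF p]])
  next
    fix \<sigma> \<tau> n p assume *: "\<sigma> permutes {..<n}" "\<tau> permutes {..<n}" "p \<in> Carr T n"
    show "Act T n (\<sigma> \<circ> \<tau>) p = Act T n \<sigma> (Act T n \<tau> p)"
      using * by (intro inj[OF _ _ d.r_act_act[OF *] e.r_act_act[OF *]] d.r_act_closed permutes_compose)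
  next
    fix \<sigma> ks p qs
    assume *: "\<sigma> permutes {..<length ks}" "p \<in> Carr T (length ks)" "args (Carr T) ks qs"
    have c: "Comp T (permute_list \<sigma> ks) p (permute_list \<sigma> qs) \<in> Carr T (sum_list ks)"
      using d.r_comp_closed[OF _ d.permuted_args(1)[OF *(1,3)], of p] *(2) d.sum_permute_list[OF *(1)] by simp
    show "Comp T ks (Act T (length ks) \<sigma> p) qs =
      Act T (sum_list ks) (block_perm \<sigma> ks) (Comp T (permute_list \<sigma> ks) p (permute_list \<sigma> qs))"
      using * c by (intro inj[OF _ _ d.r_outer[OF *] e.r_outer[OF *]] d.r_act_closed d.r_comp_closed block_perm_permutes)
  next
    fix ks \<sigma>s p qs
    assume *: "list_all2 (\<lambda>k \<sigma>. \<sigma> permutes {..<k}) ks \<sigma>s" "p \<in> Carr T (length ks)" "args (Carr T) ks qs"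
    show "Comp T ks p (map2 (\<lambda>k (\<sigma>, q). Act T k \<sigma> q) ks (zip \<sigma>s qs)) =
      Act T (sum_list ks) (sum_perm ks \<sigma>s) (Comp T ks p qs)"
      using * by (intro inj[OF _ _ d.r_inner[OF *] e.r_inner[OF *]] d.r_act_closed d.r_comp_closed
          sum_perm_permutes d.act_args)
  qed (fact d.r_comp_closed d.r_unit_closed d.r_act_closed)+
  then show "operad_hom T P d"
    unfolding operad_hom_def operad_hom_axioms_def
    using d.symmetric_operad_axioms d.d_closed d.d_comp d.d_unit d.d_act by blast
qed

lemma map2_snd: "length ks = length xs \<Longrightarrow> map2 (\<lambda>k x. x) ks xs = xs"
  by (intro nth_equalityI) auto

lemma operad_hom_id: "symmetric_operad P \<Longrightarrow> operad_hom P P (\<lambda>n x. x)"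
  unfolding operad_hom_def operad_hom_axioms_def
  by (auto simp: map2_snd dest: list_all2_lengthD)

lemma operad_hom_comp:
  assumes "operad_hom P Q f" "operad_hom Q R g"
  shows "operad_hom P R (\<lambda>n x. g n (f n x))"
proof -
  interpret f: operad_hom P Q f by fact
  interpret g: operad_hom Q R g by fact
  show ?thesis
  proof
    fix p ks qs assume *: "p \<in> Carr P (length ks)" "args (Carr P) ks qs"
    have len: "length qs = length ks" using * by (auto dest: list_all2_lengthD)
    have "args (Carr Q) ks (map2 f ks qs)"
      using * by (auto simp: list_all2_conv_all_nth f.hom_closed)
    moreover have "map2 g ks (map2 f ks qs) = map2 (\<lambda>n x. g n (f n x)) ks qs"
      by (rule nth_equalityI) (auto simp: len)
    ultimately show "g (sum_list ks) (f (sum_list ks) (Comp P ks p qs)) =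
      Comp R ks (g (length ks) (f (length ks) p)) (map2 (\<lambda>n x. g n (f n x)) ks qs)"
      using * by (simp add: f.hom_comp g.hom_comp f.hom_closed)
  qed (use f.hom_unit g.hom_unit in \<open>simp_all add: f.hom_closed g.hom_closed f.hom_act g.hom_act\<close>)
qed

text \<open>A suboperad \<open>S\<close> of \<open>P\<close>, transported along levelwise injective maps \<open>e\<close>.\<close>

definition transport ::
  "'a sym_operad \<Rightarrow> (nat \<Rightarrow> 'a set) \<Rightarrow> (nat \<Rightarrow> 'a \<Rightarrow> 'b) \<Rightarrow> 'b sym_operad" where
  "transport P S e =
     \<lparr>Carr = \<lambda>n. e n ` S n,
      Comp = \<lambda>ks p qs. e (sum_list ks)
        (Comp P ks (inv_into (S (length ks)) (e (length ks)) p) (map2 (\<lambda>k. inv_into (S k) (e k)) ks qs)),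
      Unit = e 1 (Unit P),
      Act = \<lambda>n \<sigma> p. e n (Act P n \<sigma> (inv_into (S n) (e n) p))\<rparr>"

lemma transport_operad:
  fixes e :: "nat \<Rightarrow> 'a \<Rightarrow> 'b"
  assumes "symmetric_operad P" and sub: "\<And>n. S n \<subseteq> Carr P n"
    and inj: "\<And>n. inj_on (e n) (S n)"
    and comp: "\<And>ks p qs. \<lbrakk>p \<in> S (length ks); args S ks qs\<rbrakk> \<Longrightarrow> Comp P ks p qs \<in> S (sum_list ks)"
    and unit: "Unit P \<in> S 1"
    and act: "\<And>n \<sigma> p. \<lbrakk>\<sigma> permutes {..<n}; p \<in> S n\<rbrakk> \<Longrightarrow> Act P n \<sigma> p \<in> S n"
  shows "operad_hom (transport P S e) P (\<lambda>n. inv_into (S n) (e n))"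
    and "\<And>X h. \<lbrakk>operad_hom X P h; \<And>n x. x \<in> Carr X n \<Longrightarrow> h n x \<in> S n\<rbrakk> \<Longrightarrow>
      operad_hom X (transport P S e) (\<lambda>n x. e n (h n x))"
proof -
  let ?T = "transport P S e" and ?d = "\<lambda>n. inv_into (S n) (e n)"
  interpret symmetric_operad P by fact
  have C: "x \<in> Carr ?T n \<longleftrightarrow> (\<exists>y\<in>S n. x = e n y)" for x n by (auto simp: transport_def)
  have d: "?d n (e n y) = y" if "y \<in> S n" for n y using inj that by (rule inv_into_f_f)
  have dS: "?d n x \<in> S n" if "x \<in> Carr ?T n" for n x using that d by (auto simp: C)
  have aS: "args S ks (map2 ?d ks qs)" if "args (Carr ?T) ks qs" for ks qs
    using that dS by (auto simp: list_all2_conv_all_nth)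
  have refl: "operad_reflection P ?T ?d"
  proof
    fix p ks qs assume *: "p \<in> Carr ?T (length ks)" "args (Carr ?T) ks qs"
    note c = comp[OF dS[OF *(1)] aS[OF *(2)]]
    show "Comp ?T ks p qs \<in> Carr ?T (sum_list ks)"
      using c by (simp add: transport_def)
    show "?d (sum_list ks) (Comp ?T ks p qs) = Comp P ks (?d (length ks) p) (map2 ?d ks qs)"
      using d[OF c] by (simp add: transport_def)
  next
    show "Unit ?T \<in> Carr ?T 1" using unit by (simp add: transport_def)
    show "?d 1 (Unit ?T) = Unit P" using d[OF unit] by (simp add: transport_def)
  next
    fix \<sigma> n p assume *: "\<sigma> permutes {..<n}" "p \<in> Carr ?T n"
    note c = act[OF *(1) dS[OF *(2)]]
    show "Act ?T n \<sigma> p \<in> Carr ?T n" using c by (simp add: transport_def)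
    show "?d n (Act ?T n \<sigma> p) = Act P n \<sigma> (?d n p)" using d[OF c] by (simp add: transport_def)
  next
    fix p n assume "p \<in> Carr ?T n"
    then show "?d n p \<in> Carr P n" using dS sub by blast
  qed
  have dinj: "x = y" if "x \<in> Carr ?T n" "y \<in> Carr ?T n" "?d n x = ?d n y" for n x y
    using that d by (auto simp: C)
  show "operad_hom ?T P ?d"
    by (rule symmetric_operad_reflect(2)[OF refl refl]) (rule dinj)
  have T: "symmetric_operad ?T"
    by (rule symmetric_operad_reflect(1)[OF refl refl]) (rule dinj)
  show "operad_hom X ?T (\<lambda>n x. e n (h n x))"
    if "operad_hom X P h" and hS: "\<And>n x. x \<in> Carr X n \<Longrightarrow> h n x \<in> S n" for X h
  proof -
    interpret h: operad_hom X P h by fact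
    show ?thesis
    proof (intro operad_hom.intro operad_hom_axioms.intro T h.dom.symmetric_operad_axioms)
      fix p n assume "p \<in> Carr X n"
      then show "e n (h n p) \<in> Carr ?T n" using hS by (auto simp: C)
    next
      fix p ks qs assume *: "p \<in> Carr X (length ks)" "args (Carr X) ks qs"
      have "map2 ?d ks (map2 (\<lambda>n x. e n (h n x)) ks qs) = map2 h ks qs"
        using list_all2_nthD[OF *(2)] list_all2_lengthD[OF *(2)] hS d
        by (intro nth_equalityI) auto
      then show "e (sum_list ks) (h (sum_list ks) (Comp X ks p qs)) =
        Comp ?T ks (e (length ks) (h (length ks) p)) (map2 (\<lambda>n x. e n (h n x)) ks qs)"
        using * d[OF hS[OF *(1)]] by (simp add: h.hom_comp transport_def)
    next
      show "e 1 (h 1 (Unit X)) = Unit ?T" using h.hom_unit by (simp add: transport_def)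
    next
      fix \<sigma> n p assume "\<sigma> permutes {..<n}" "p \<in> Carr X n"
      then show "e n (h n (Act X n \<sigma> p)) = Act ?T n \<sigma> (e n (h n p))"
        using d hS by (simp add: h.hom_act transport_def)
    qed
  qed
qed

lemma image_suboperad:
  assumes "operad_hom X Z h"
  defines "S \<equiv> \<lambda>n. h n ` Carr X n"
  shows "S n \<subseteq> Carr Z n"
    and "\<lbrakk>p \<in> S (length ks); args S ks qs\<rbrakk> \<Longrightarrow> Comp Z ks p qs \<in> S (sum_list ks)"
    and "Unit Z \<in> S 1"
    and "\<lbrakk>\<sigma> permutes {..<n}; p \<in> S n\<rbrakk> \<Longrightarrow> Act Z n \<sigma> p \<in> S n"
proof -
  interpret h: operad_hom X Z h by fact
  show "S n \<subseteq> Carr Z n" using h.hom_closed by (auto simp: S_def)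
  show "Unit Z \<in> S 1" using h.hom_unit h.dom.unit_closed unfolding S_def by (metis imageI)
  show "Act Z n \<sigma> p \<in> S n" if "\<sigma> permutes {..<n}" "p \<in> S n"
    using that h.dom.act_closed by (auto simp: S_def simp flip: h.hom_act)
  show "Comp Z ks p qs \<in> S (sum_list ks)" if p: "p \<in> S (length ks)" and qs: "args S ks qs"
  proof -
    obtain x where x: "x \<in> Carr X (length ks)" "p = h (length ks) x" using p by (auto simp: S_def)
    define ys where "ys = map2 (\<lambda>k q. SOME y. y \<in> Carr X k \<and> q = h k y) ks qs"
    have len: "length qs = length ks" using qs by (auto dest: list_all2_lengthD)
    have y: "ys ! i \<in> Carr X (ks ! i) \<and> qs ! i = h (ks ! i) (ys ! i)" if "i < length ks" for i
    proof -
      have "\<exists>y. y \<in> Carr X (ks ! i) \<and> qs ! i = h (ks ! i) y"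
        using list_all2_nthD[OF qs that] by (auto simp: S_def)
      from someI_ex[OF this] show ?thesis using that len by (simp add: ys_def)
    qed
    have ly: "length ys = length ks" by (simp add: ys_def len)
    have a: "args (Carr X) ks ys" using y ly by (simp add: list_all2_conv_all_nth)
    have "qs = map2 h ks ys" using y len ly by (intro nth_equalityI) auto
    then have "Comp Z ks p qs = h (sum_list ks) (Comp X ks x ys)"
      using h.hom_comp[OF x(1) a] x(2) by simp
    then show ?thesis using h.dom.comp_closed[OF x(1) a] by (simp add: S_def)
  qed
qed

lemma coequalizerD:
  fixes X :: "'x sym_operad" and Y :: "'y sym_operad" and Z :: "('x + 'y) sym_operad"
  assumes "coequalizer A X Y u v q" "operad_hom X Z h"
    and "\<And>n a. a \<in> Carr A n \<Longrightarrow> h n (u n a) = h n (v n a)"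
  shows "\<exists>g. operad_hom Y Z g \<and> (\<forall>n. \<forall>x\<in>Carr X n. g n (q n x) = h n x) \<and>
    (\<forall>g'. operad_hom Y Z g' \<and> (\<forall>n. \<forall>x\<in>Carr X n. g' n (q n x) = h n x) \<longrightarrow>
       (\<forall>n. \<forall>y\<in>Carr Y n. g' n y = g n y))"
  using assms unfolding coequalizer_def by blast

lemma coequalizer_surj:
  fixes X :: "'x sym_operad" and Y :: "'y sym_operad"
  assumes "coequalizer A X Y u v q" and y: "y \<in> Carr Y n"
  shows "y \<in> q n ` Carr X n"
proof -
  have q: "operad_hom X Y q" and quv: "\<And>n a. a \<in> Carr A n \<Longrightarrow> q n (u n a) = q n (v n a)"
    using assms(1) unfolding coequalizer_def by blast+
  note univ = coequalizerD[OF assms(1)]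
  interpret q: operad_hom X Y q by fact
  let ?e = "\<lambda>n::nat. Inr :: 'y \<Rightarrow> 'x + 'y"
  let ?S = "\<lambda>n. q n ` Carr X n"
  let ?d = "\<lambda>n. inv_into (?S n) (?e n)"
  let ?I = "transport Y ?S ?e" and ?Y = "transport Y (Carr Y) ?e"
  note tI = transport_operad[OF q.cod.symmetric_operad_axioms image_suboperad(1)[OF q] _ image_suboperad(2-4)[OF q], where e = ?e]
  note tY = transport_operad[OF q.cod.symmetric_operad_axioms subset_refl _ q.cod.comp_closed q.cod.unit_closed q.cod.act_closed, where e = ?e]
  have dI: "operad_hom ?I Y ?d" by (rule tI(1)) simp_all
  have hI: "operad_hom X ?I (\<lambda>n x. ?e n (q n x))" by (rule tI(2)) (use q in auto)
  have eY: "operad_hom W ?Y (\<lambda>n x. ?e n (h n x))" if "operad_hom W Y h" for W :: "'w sym_operad" and h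
    by (rule tY(2)) (use that in \<open>auto intro: operad_hom.hom_closed\<close>)
  obtain g where g: "operad_hom Y ?I g" "\<And>n x. x \<in> Carr X n \<Longrightarrow> g n (q n x) = Inr (q n x)"
    using univ[OF hI] quv by auto
  have dg: "operad_hom Y Y (\<lambda>n y. ?d n (g n y))" using operad_hom_comp[OF g(1) dI] .
  have dq: "?d n (Inr (q n x)) = q n x" if "x \<in> Carr X n" for n x
    using that by (intro inv_into_f_f) auto
  obtain k where k: "\<And>g'. operad_hom Y ?Y g' \<Longrightarrow> (\<And>n x. x \<in> Carr X n \<Longrightarrow> g' n (q n x) = Inr (q n x)) \<Longrightarrow>
      (\<forall>n. \<forall>y\<in>Carr Y n. g' n y = k n y)"
    using univ[OF eY[OF q]] quv by (auto, metis)
  have "Inr (?d n (g n y)) = k n y" using k[OF eY[OF dg]] g dq y by auto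
  moreover have "Inr y = k n y" using k[OF eY[OF operad_hom_id]] q.cod.symmetric_operad_axioms y by auto
  ultimately have "y = ?d n (g n y)" by (metis sum.inject(2))
  moreover have "?d n (g n y) \<in> ?S n"
    using operad_hom.hom_closed[OF g(1) y] by (intro inv_into_into) (simp add: transport_def)
  ultimately show ?thesis by simp
qed

theorem coequalizer_universal:
  fixes X :: "'x sym_operad" and Y :: "'y sym_operad" and Z :: "'z sym_operad"
  assumes "coequalizer A X Y u v q" and h: "operad_hom X Z h"
    and huv: "\<And>n a. a \<in> Carr A n \<Longrightarrow> h n (u n a) = h n (v n a)"
  shows "\<exists>g. operad_hom Y Z g \<and> (\<forall>n. \<forall>x\<in>Carr X n. g n (q n x) = h n x) \<and>
    (\<forall>g'. operad_hom Y Z g' \<and> (\<forall>n. \<forall>x\<in>Carr X n. g' n (q n x) = h n x) \<longrightarrow>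
       (\<forall>n. \<forall>y\<in>Carr Y n. g' n y = g n y))"
proof -
  interpret h: operad_hom X Z h by fact
  define e :: "nat \<Rightarrow> 'z \<Rightarrow> 'x + 'y" where "e n z = Inl (inv_into (Carr X n) (h n) z)" for n z
  let ?S = "\<lambda>n. h n ` Carr X n"
  let ?d = "\<lambda>n. inv_into (?S n) (e n)"
  have inj: "inj_on (e n) (?S n)" for n
    unfolding e_def by (auto intro!: inj_onI dest: inv_into_injective)
  note t = transport_operad[OF h.cod.symmetric_operad_axioms image_suboperad(1)[OF h] inj image_suboperad(2-4)[OF h]]
  have "operad_hom X (transport Z ?S e) (\<lambda>n x. e n (h n x))" by (rule t(2)) (use h in auto)
  with coequalizerD[OF assms(1) this] huv
  obtain g where g: "operad_hom Y (transport Z ?S e) g"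
    "\<And>n x. x \<in> Carr X n \<Longrightarrow> g n (q n x) = e n (h n x)"
    by auto
  have "operad_hom Y Z (\<lambda>n y. ?d n (g n y))"
    by (rule operad_hom_comp[OF g(1) t(1)]) 
  moreover have "\<forall>n. \<forall>x\<in>Carr X n. ?d n (g n (q n x)) = h n x"
    using g(2) inj by (auto intro!: inv_into_f_f)
  moreover have "\<forall>n. \<forall>y\<in>Carr Y n. g' n y = ?d n (g n y)"
    if "\<forall>n. \<forall>x\<in>Carr X n. g' n (q n x) = h n x" for g'
    using that coequalizer_surj[OF assms(1)] calculation(2) by (metis imageE)
  ultimately show ?thesis by blast
qed


section \<open>Existence of weakenings\<close>

text \<open>An arrow is a pair of elements with the same image.\<close>

definition pair_operad :: "'a sym_operad \<Rightarrow> (nat \<Rightarrow> 'a \<Rightarrow> 'b) \<Rightarrow> ('a \<times> 'a) sym_operad" where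
  "pair_operad X \<phi> =
     \<lparr>Carr = \<lambda>n. {(x, y). x \<in> Carr X n \<and> y \<in> Carr X n \<and> \<phi> n x = \<phi> n y},
      Comp = \<lambda>ks p qs. (Comp X ks (fst p) (map fst qs), Comp X ks (snd p) (map snd qs)),
      Unit = (Unit X, Unit X),
      Act = \<lambda>n \<sigma> p. (Act X n \<sigma> (fst p), Act X n \<sigma> (snd p))\<rparr>"

definition weakening :: "'a sym_operad \<Rightarrow> (nat \<Rightarrow> 'a \<Rightarrow> 'b) \<Rightarrow> ('a, 'a \<times> 'a) cat_operad" where
  "weakening X \<phi> =
     \<lparr>Cat = \<lambda>n. \<lparr>Obj = Carr X n, Arr = Carr (pair_operad X \<phi>) n, Dom = fst, Cod = snd,
        Idn = \<lambda>x. (x, x), Cmp = \<lambda>g f. (fst f, snd g)\<rparr>,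
      OComp = Comp X, AComp = Comp (pair_operad X \<phi>), OUnit = Unit X,
      OAct = Act X, AAct = Act (pair_operad X \<phi>)\<rparr>"

lemma map2_map: "length ks = length xs \<Longrightarrow> map2 (\<lambda>k. f) ks xs = map f xs"
  by (intro nth_equalityI) auto

lemma pair_operad:
  assumes "operad_hom X P \<phi>"
  shows "symmetric_operad (pair_operad X \<phi>)"
    "operad_hom (pair_operad X \<phi>) X (\<lambda>n. fst)" "operad_hom (pair_operad X \<phi>) X (\<lambda>n. snd)"
proof -
  interpret \<phi>: operad_hom X P \<phi> by fact
  let ?T = "pair_operad X \<phi>"
  have C: "p \<in> Carr ?T n \<longleftrightarrow> fst p \<in> Carr X n \<and> snd p \<in> Carr X n \<and> \<phi> n (fst p) = \<phi> n (snd p)" for p n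
    by (auto simp: pair_operad_def)
  have a: "args (Carr X) ks (map fst qs)" "args (Carr X) ks (map snd qs)"
    "map2 \<phi> ks (map fst qs) = map2 \<phi> ks (map snd qs)" "length ks = length qs"
    if "args (Carr ?T) ks qs" for ks qs
    using that unfolding list_all2_conv_all_nth by (auto simp: C intro!: nth_equalityI)
  have closed: "Comp ?T ks p qs \<in> Carr ?T (sum_list ks)"
    if p: "p \<in> Carr ?T (length ks)" and qs: "args (Carr ?T) ks qs" for ks p qs
    using p a[OF qs] by (simp add: C) (simp add: pair_operad_def \<phi>.dom.comp_closed \<phi>.hom_comp)
  have r: "operad_reflection X ?T (\<lambda>n. fst)" "operad_reflection X ?T (\<lambda>n. snd)"
    using closed a(4) \<phi>.dom.unit_closed \<phi>.dom.act_closed \<phi>.hom_act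
    by (unfold_locales; simp add: C; simp add: pair_operad_def map2_map)+
  show "symmetric_operad ?T" "operad_hom ?T X (\<lambda>n. fst)"
    by (rule symmetric_operad_reflect[OF r]; simp add: prod_eq_iff)+
  show "operad_hom ?T X (\<lambda>n. snd)"
    by (rule symmetric_operad_reflect(2)[OF r(2) r(1)]; simp add: prod_eq_iff)
qed

lemma discrete_category: "category (discrete_category S)"
  by unfold_locales (auto simp: discrete_category_def Hom_def)

lemma discrete_operad_sel [simp]:
  "obj_operad (discrete_operad P) = (P :: 'a sym_operad)"
  "arr_operad (discrete_operad P) = (P :: 'a sym_operad)"
  "Obj (Cat (discrete_operad P) n) = Carr P n" "Arr (Cat (discrete_operad P) n) = Carr P n"
  "Dom (Cat (discrete_operad P) n) p = p" "Cod (Cat (discrete_operad P) n) p = p"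
  "Idn (Cat (discrete_operad P) n) p = p" "Cmp (Cat (discrete_operad P) n) q p = p"
  "OComp (discrete_operad P) = Comp P" "AComp (discrete_operad P) = Comp P"
  "OAct (discrete_operad P) = Act P" "AAct (discrete_operad P) = Act P"
  "Cat (discrete_operad P) n = discrete_category (Carr P n)"
  by (simp_all add: obj_operad_def arr_operad_def discrete_operad_def discrete_category_def)

lemma discrete_sym_cat_operad:
  assumes "symmetric_operad P"
  shows "sym_cat_operad (discrete_operad P)"
proof -
  interpret symmetric_operad P by fact
  have m: "map2 (\<lambda>k (x, y). y) ks (zip xs ys) = ys"
    if "args (Carr P) ks xs" "args (Carr P) ks ys" for ks :: "nat list" and xs ys :: "'a list"
    using that[THEN list_all2_lengthD] by (intro nth_equalityI) auto
  have m': "map2 (\<lambda>k x. x) ks xs = xs"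
    if "args (Carr P) ks xs" for ks :: "nat list" and xs :: "'a list"
    using that[THEN list_all2_lengthD] by (rule map2_snd)
  have A: "cat_functor (Cat (discrete_operad P) n) (Cat (discrete_operad P) n) (Act P n \<sigma>) (Act P n \<sigma>)"
    if "\<sigma> permutes {..<n}" for n \<sigma>
    unfolding cat_functor_def cat_functor_axioms_def
    using act_closed[OF that] by (auto simp: discrete_category Hom_def) (auto simp: discrete_category_def)
  show ?thesis
    unfolding sym_cat_operad_def
    using A by (simp add: discrete_category symmetric_operad_axioms)
      (auto simp: Hom_def discrete_category_def m m' comp_closed)
qed

lemma weakening_sel [simp]:
  "obj_operad (weakening X \<phi>) = (X :: 'a sym_operad)"
  "arr_operad (weakening X \<phi>) = pair_operad X \<phi>"
  "Obj (Cat (weakening X \<phi>) n) = Carr X n" "Arr (Cat (weakening X \<phi>) n) = Carr (pair_operad X \<phi>) n"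
  "Dom (Cat (weakening X \<phi>) n) = fst" "Cod (Cat (weakening X \<phi>) n) = snd"
  "Idn (Cat (weakening X \<phi>) n) x = (x, x)" "Cmp (Cat (weakening X \<phi>) n) g f = (fst f, snd g)"
  "OComp (weakening X \<phi>) = Comp X" "AComp (weakening X \<phi>) = Comp (pair_operad X \<phi>)"
  "OAct (weakening X \<phi>) = Act X" "AAct (weakening X \<phi>) = Act (pair_operad X \<phi>)"
  by (simp_all add: obj_operad_def arr_operad_def weakening_def pair_operad_def)

lemma weakening_Hom:
  "f \<in> Hom (Cat (weakening X \<phi>) n) x y \<longleftrightarrow>
   f = (x, y) \<and> x \<in> Carr X n \<and> y \<in> Carr X n \<and> \<phi> n x = \<phi> n y"
  by (cases f) (auto simp: Hom_def pair_operad_def)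

lemma pair_operad_sel:
  "p \<in> Carr (pair_operad X \<phi>) n \<longleftrightarrow> fst p \<in> Carr X n \<and> snd p \<in> Carr X n \<and> \<phi> n (fst p) = \<phi> n (snd p)"
  "Comp (pair_operad X \<phi>) ks p qs = (Comp X ks (fst p) (map fst qs), Comp X ks (snd p) (map snd qs))"
  "Act (pair_operad X \<phi>) n \<sigma> p = (Act X n \<sigma> (fst p), Act X n \<sigma> (snd p))"
  by (auto simp: pair_operad_def)

lemma weakening_category: "category (Cat (weakening X \<phi>) n)"
  by unfold_locales (auto simp: weakening_Hom pair_operad_sel)

lemma weakening_sym_cat_operad:
  assumes "operad_hom X P \<phi>"
  shows "sym_cat_operad (weakening X \<phi>)"
proof -
  interpret \<phi>: operad_hom X P \<phi> by fact
  interpret p: symmetric_operad "pair_operad X \<phi>" using assms by (rule pair_operad)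
  show ?thesis
  proof (rule sym_cat_operad.intro)
    show "category (Cat (weakening X \<phi>) n)" for n by (rule weakening_category)
    show "symmetric_operad (obj_operad (weakening X \<phi>))" "symmetric_operad (arr_operad (weakening X \<phi>))"
      by (simp_all add: \<phi>.dom.symmetric_operad_axioms p.symmetric_operad_axioms)
  next
    fix f ks gs
    assume *: "f \<in> Arr (Cat (weakening X \<phi>) (length ks))"
      "args (\<lambda>k. Arr (Cat (weakening X \<phi>) k)) ks gs"
    then have "Comp (pair_operad X \<phi>) ks f gs \<in> Carr (pair_operad X \<phi>) (sum_list ks)"
      by (intro p.comp_closed) simp_all
    with * show "AComp (weakening X \<phi>) ks f gs \<in> Hom (Cat (weakening X \<phi>) (sum_list ks))
         (OComp (weakening X \<phi>) ks (Dom (Cat (weakening X \<phi>) (length ks)) f)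
            (map2 (\<lambda>k. Dom (Cat (weakening X \<phi>) k)) ks gs))
         (OComp (weakening X \<phi>) ks (Cod (Cat (weakening X \<phi>) (length ks)) f)
            (map2 (\<lambda>k. Cod (Cat (weakening X \<phi>) k)) ks gs))"
      by (auto simp: Hom_def pair_operad_sel map2_map dest: list_all2_lengthD)
  next
    fix x ks ys
    assume *: "x \<in> Obj (Cat (weakening X \<phi>) (length ks))"
      "args (\<lambda>k. Obj (Cat (weakening X \<phi>) k)) ks ys"
    then show "AComp (weakening X \<phi>) ks (Idn (Cat (weakening X \<phi>) (length ks)) x)
        (map2 (\<lambda>k. Idn (Cat (weakening X \<phi>) k)) ks ys) =
      Idn (Cat (weakening X \<phi>) (sum_list ks)) (OComp (weakening X \<phi>) ks x ys)"
      using list_all2_lengthD[OF *(2)]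
      by (simp add: pair_operad_sel map2_map[of ks ys "\<lambda>x. (x, x)"] comp_def)
  next
    fix f f' ks gs gs'
    assume "args (\<lambda>k. Arr (Cat (weakening X \<phi>) k)) ks gs"
      "args (\<lambda>k. Arr (Cat (weakening X \<phi>) k)) ks gs'"
    then have l: "length gs = length ks" "length gs' = length ks" by (auto dest: list_all2_lengthD)
    have "map fst (map2 (\<lambda>k (g', g). (fst g, snd g')) ks (zip gs' gs)) = map fst gs"
      "map snd (map2 (\<lambda>k (g', g). (fst g, snd g')) ks (zip gs' gs)) = map snd gs'"
      using l by (auto intro!: nth_equalityI)
    then show "AComp (weakening X \<phi>) ks (Cmp (Cat (weakening X \<phi>) (length ks)) f' f)
         (map2 (\<lambda>k (g', g). Cmp (Cat (weakening X \<phi>) k) g' g) ks (zip gs' gs)) =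
       Cmp (Cat (weakening X \<phi>) (sum_list ks)) (AComp (weakening X \<phi>) ks f' gs')
         (AComp (weakening X \<phi>) ks f gs)"
      by (simp add: pair_operad_sel del: map_map)
  next
    fix \<sigma> and n :: nat assume "\<sigma> permutes {..<n}"
    then show "cat_functor (Cat (weakening X \<phi>) n) (Cat (weakening X \<phi>) n)
      (OAct (weakening X \<phi>) n \<sigma>) (AAct (weakening X \<phi>) n \<sigma>)"
      unfolding cat_functor_def cat_functor_axioms_def
      by (auto simp: weakening_category weakening_Hom pair_operad_sel \<phi>.dom.act_closed \<phi>.hom_act)
  qed
qed

theorem weakening_is_weakening:
  assumes "operad_hom (free_operad \<Phi>) P \<phi>"
  shows "is_weakening \<Phi> P \<phi> (weakening (free_operad \<Phi>) \<phi>)"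
proof -
  let ?X = "free_operad \<Phi>" and ?b = "(\<lambda>n x. x, \<lambda>n x. (x, x))" and ?f = "(\<phi>, \<lambda>n p. \<phi> n (fst p))"
  interpret \<phi>: operad_hom ?X P \<phi> by fact
  note X = \<phi>.dom.symmetric_operad_axioms and P = \<phi>.cod.symmetric_operad_axioms
  note p = pair_operad[OF assms]
  have diag: "operad_hom ?X (pair_operad ?X \<phi>) (\<lambda>n x. (x, x))"
    unfolding operad_hom_def operad_hom_axioms_def
  proof (intro conjI allI impI X p)
    fix p :: "'a tm" and ks qs
    assume "args (Carr ?X) ks qs"
    then show "(Comp ?X ks p qs, Comp ?X ks p qs) =
      Comp (pair_operad ?X \<phi>) ks (p, p) (map2 (\<lambda>n x. (x, x)) ks qs)"
      using map2_map[of ks qs "\<lambda>x. (x, x)"] by (simp add: pair_operad_sel comp_def list_all2_lengthD)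
  qed (simp_all add: pair_operad_sel, simp add: pair_operad_def)
  have "cat_operad_map (discrete_operad ?X) (weakening ?X \<phi>) ?b"
    unfolding cat_operad_map_def cat_operad_map_axioms_def cat_functor_def cat_functor_axioms_def
    using diag by (auto simp: discrete_sym_cat_operad[OF X] weakening_sym_cat_operad[OF assms] discrete_category
        weakening_category weakening_Hom operad_hom_id[OF X])
      (auto simp: Hom_def discrete_category_def)
  moreover have "cat_operad_map (weakening ?X \<phi>) (discrete_operad P) ?f"
    unfolding cat_operad_map_def cat_operad_map_axioms_def cat_functor_def cat_functor_axioms_def
    using assms operad_hom_comp[OF p(2) assms]
    by (auto simp: discrete_sym_cat_operad[OF P] weakening_sym_cat_operad[OF assms] discrete_category
        weakening_category weakening_Hom)
      (auto simp: Hom_def discrete_category_def \<phi>.hom_closed)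
  moreover have "bijective_on_objects (discrete_operad ?X) (weakening ?X \<phi>) ?b"
    by (auto simp: bijective_on_objects_def bij_betw_def) (auto simp: discrete_category_def)
  moreover have "full_and_faithful (weakening ?X \<phi>) (discrete_operad P) ?f"
    unfolding full_and_faithful_def bij_betw_def inj_on_def
    by (auto simp: weakening_Hom image_iff) (auto simp: Hom_def discrete_category_def \<phi>.hom_closed)
  ultimately show ?thesis
    unfolding is_weakening_def by (intro exI[of _ ?b] exI[of _ ?f]) (simp add: comp_map_def)
qed

end

theory Submission
  imports Defs
begin

text \<open>
  In a weakening \<open>W\<close> of \<open>P\<close> with respect to \<open>\<phi>\<close>, full faithfulness of \<open>W \<rightarrow> D\<^sub>*P\<close> means that
  there is exactly one arrow between two objects of the same arity with the same image in \<open>P\<close>,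
  and none otherwise. Two parallel arrows are therefore equal, so every equation between arrows
  of \<open>W\<close> holds as soon as its two sides have the same domain and codomain. It follows that
  \<^item> a morphism into the operad of objects of \<open>W\<close> extends to arrows as soon as it identifies the
    images in \<open>P\<close> of the two ends of every arrow (\<open>extend_map\<close>), and
  \<^item> two morphisms into \<open>W\<close> that agree after projection to \<open>P\<close> are isomorphic
    (\<open>maps_over_base_isomorphic\<close>).

  Hence two weakenings of \<open>P\<close> are equivalent once there are operad morphisms over \<open>P\<close> in both
  directions between their operads of objects (\<open>equivalent_over_base\<close>). These operads of objects
  are free, because the comparison with the free operad is bijective on objects. Free operads are
  projective with respect to levelwise surjective morphisms (\<open>free_operad_projective\<close>), so such
  morphisms exist if both projections to \<open>P\<close> are surjective on objects. For the given weakening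
  this holds because regular epimorphisms of operads are surjective, and for the unbiased one
  because each \<open>p\<close> is the value of the counit at the generator \<open>p\<close>.
\<close>

section \<open>Cat-operads with at most one arrow between two objects\<close>

text \<open>
  The essential structure of a weakening. The labelling \<open>\<kappa>\<close> plays the part of the projection
  to \<open>P\<close> on objects; since arrows are determined by their ends, only the induced equivalence
  relation on objects matters, and compatibility of \<open>\<kappa>\<close> with composition is a consequence.
\<close>

locale thin_cat_operad = sym_cat_operad W
  for W :: "('o, 'm) cat_operad" +
  fixes \<kappa> :: "nat \<Rightarrow> 'o \<Rightarrow> 'k"
  assumes ex1_arrow:
      "\<lbrakk>x \<in> Obj (Cat W n); y \<in> Obj (Cat W n); \<kappa> n x = \<kappa> n y\<rbrakk> \<Longrightarrow> \<exists>!a. a \<in> Hom (Cat W n) x y"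
    and arrow_label: "a \<in> Hom (Cat W n) x y \<Longrightarrow> \<kappa> n x = \<kappa> n y"
begin

definition arrow :: "nat \<Rightarrow> 'o \<Rightarrow> 'o \<Rightarrow> 'm" where
  "arrow n x y = (THE a. a \<in> Hom (Cat W n) x y)"

lemma arrow_hom:
  "\<lbrakk>x \<in> Obj (Cat W n); y \<in> Obj (Cat W n); \<kappa> n x = \<kappa> n y\<rbrakk> \<Longrightarrow> arrow n x y \<in> Hom (Cat W n) x y"
  unfolding arrow_def by (rule theI') (rule ex1_arrow)

lemma Hom_Obj: "a \<in> Hom (Cat W n) x y \<Longrightarrow> x \<in> Obj (Cat W n) \<and> y \<in> Obj (Cat W n)"
  using category.dom_closed[OF category] category.cod_closed[OF category] by (auto simp: Hom_def)

lemma thin: "\<lbrakk>a \<in> Hom (Cat W n) x y; b \<in> Hom (Cat W n) x y\<rbrakk> \<Longrightarrow> a = b"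
  using ex1_arrow Hom_Obj arrow_label by blast

lemma acomp_hom':
  assumes "a \<in> Hom (Cat W (length ks)) x y" "length bs = length ks" "length us = length ks"
    "length vs = length ks"
    and "\<And>i. i < length ks \<Longrightarrow> bs ! i \<in> Hom (Cat W (ks ! i)) (us ! i) (vs ! i)"
  shows "AComp W ks a bs \<in> Hom (Cat W (sum_list ks)) (OComp W ks x us) (OComp W ks y vs)"
proof -
  have "args (\<lambda>k. Arr (Cat W k)) ks bs"
    using assms by (auto simp: list_all2_conv_all_nth Hom_def)
  moreover have "a \<in> Arr (Cat W (length ks))" using assms(1) by (simp add: Hom_def)
  moreover have "map2 (\<lambda>k. Dom (Cat W k)) ks bs = us" "map2 (\<lambda>k. Cod (Cat W k)) ks bs = vs"
    using assms by (auto intro!: nth_equalityI simp: Hom_def)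
  ultimately show ?thesis using acomp_hom[of a ks bs] assms(1) by (simp add: Hom_def)
qed

lemma act_hom:
  assumes "\<sigma> permutes {..<n}" "a \<in> Hom (Cat W n) x y"
  shows "AAct W n \<sigma> a \<in> Hom (Cat W n) (OAct W n \<sigma> x) (OAct W n \<sigma> y)"
  using cat_functor.functor_hom[OF act_functor] assms Hom_Obj by blast

lemma idn_hom: "x \<in> Obj (Cat W n) \<Longrightarrow> Idn (Cat W n) x \<in> Hom (Cat W n) x x"
  by (rule category.idn_hom[OF category])

lemma cmp_hom:
  "\<lbrakk>a \<in> Hom (Cat W n) x y; b \<in> Hom (Cat W n) y z\<rbrakk> \<Longrightarrow> Cmp (Cat W n) b a \<in> Hom (Cat W n) x z"
  by (rule category.cmp_hom[OF category])

text \<open>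
  The arrow part is forced: it must send \<open>a\<close> to the only arrow between the images of its ends.
  Functoriality and compatibility with the operad structure then hold by thinness.
\<close>

lemma extend_map:
  fixes Q :: "('o2, 'm2) cat_operad"
  assumes "sym_cat_operad Q" and h: "operad_hom (obj_operad Q) (obj_operad W) h"
    and lab: "\<And>n x y a. a \<in> Hom (Cat Q n) x y \<Longrightarrow> \<kappa> n (h n x) = \<kappa> n (h n y)"
  shows "cat_operad_map Q W (h, \<lambda>n a. arrow n (h n (Dom (Cat Q n) a)) (h n (Cod (Cat Q n) a)))"
    (is "cat_operad_map Q W (h, ?k)")
proof -
  interpret Q: sym_cat_operad Q by fact
  interpret h: operad_hom "obj_operad Q" "obj_operad W" h by fact
  have ho: "h n x \<in> Obj (Cat W n)" if "x \<in> Obj (Cat Q n)" for n x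
    using h.hom_closed that by (simp add: obj_operad_def)
  have QO: "x \<in> Obj (Cat Q n)" "y \<in> Obj (Cat Q n)" if "a \<in> Hom (Cat Q n) x y" for n a x y
    using that category.dom_closed[OF Q.category] category.cod_closed[OF Q.category]
    by (auto simp: Hom_def)
  have k: "?k n a \<in> Hom (Cat W n) (h n x) (h n y)" if "a \<in> Hom (Cat Q n) x y" for n a x y
    using arrow_hom[OF ho[OF QO(1)[OF that]] ho[OF QO(2)[OF that]] lab[OF that]] that
    by (simp add: Hom_def)
  have k_arr: "?k n a \<in> Hom (Cat W n) (h n (Dom (Cat Q n) a)) (h n (Cod (Cat Q n) a))"
    if "a \<in> Arr (Cat Q n)" for n a
    using that by (intro k) (simp add: Hom_def)
  have k_idn: "?k n (Idn (Cat Q n) x) = Idn (Cat W n) (h n x)" if "x \<in> Obj (Cat Q n)" for n x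
    using k[OF category.idn_hom[OF Q.category that]] idn_hom[OF ho[OF that]] by (rule thin)
  have "cat_functor (Cat Q n) (Cat W n) (h n) (?k n)" for n
  proof (intro cat_functor.intro cat_functor_axioms.intro Q.category category)
    fix x y z a b assume ab: "a \<in> Hom (Cat Q n) x y" "b \<in> Hom (Cat Q n) y z"
    show "?k n (Cmp (Cat Q n) b a) = Cmp (Cat W n) (?k n b) (?k n a)"
      using k[OF category.cmp_hom[OF Q.category ab]] cmp_hom[OF k[OF ab(1)] k[OF ab(2)]]
      by (rule thin)
  qed (use ho k k_idn in auto)
  moreover have "operad_hom (arr_operad Q) (arr_operad W) ?k"
  proof (intro operad_hom.intro operad_hom_axioms.intro Q.arr_operad arr_operad)
    fix a n assume "a \<in> Carr (arr_operad Q) n"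
    then show "?k n a \<in> Carr (arr_operad W) n"
      using k_arr by (simp add: arr_operad_def Hom_def)
  next
    fix a ks bs assume "a \<in> Carr (arr_operad Q) (length ks)" "args (Carr (arr_operad Q)) ks bs"
    then have a: "a \<in> Arr (Cat Q (length ks))" and bs: "args (\<lambda>k. Arr (Cat Q k)) ks bs"
      by (simp_all add: arr_operad_def)
    have len: "length bs = length ks" using bs by (simp add: list_all2_lengthD)
    let ?ds = "map2 (\<lambda>k. Dom (Cat Q k)) ks bs" and ?cs = "map2 (\<lambda>k. Cod (Cat Q k)) ks bs"
    let ?x = "Dom (Cat Q (length ks)) a" and ?y = "Cod (Cat Q (length ks)) a"
    have ds: "args (\<lambda>k. Obj (Cat Q k)) ks ?ds" "args (\<lambda>k. Obj (Cat Q k)) ks ?cs"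
      using bs len category.dom_closed[OF Q.category] category.cod_closed[OF Q.category]
      by (auto simp: list_all2_conv_all_nth)
    have xy: "?x \<in> Obj (Cat Q (length ks))" "?y \<in> Obj (Cat Q (length ks))"
      using a category.dom_closed[OF Q.category] category.cod_closed[OF Q.category] by auto
    have "?k (sum_list ks) (AComp Q ks a bs) = AComp W ks (?k (length ks) a) (map2 ?k ks bs)"
    proof (rule thin)
      show "?k (sum_list ks) (AComp Q ks a bs) \<in> Hom (Cat W (sum_list ks))
          (h (sum_list ks) (OComp Q ks ?x ?ds)) (h (sum_list ks) (OComp Q ks ?y ?cs))"
        by (rule k[OF Q.acomp_hom[OF a bs]])
      have "AComp W ks (?k (length ks) a) (map2 ?k ks bs) \<in> Hom (Cat W (sum_list ks))
          (OComp W ks (h (length ks) ?x) (map2 h ks ?ds))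
          (OComp W ks (h (length ks) ?y) (map2 h ks ?cs))"
        using k_arr[OF a] len list_all2_nthD[OF bs] k_arr by (intro acomp_hom') auto
      then show "AComp W ks (?k (length ks) a) (map2 ?k ks bs) \<in> Hom (Cat W (sum_list ks))
          (h (sum_list ks) (OComp Q ks ?x ?ds)) (h (sum_list ks) (OComp Q ks ?y ?cs))"
        using h.hom_comp[of ?x ks ?ds] h.hom_comp[of ?y ks ?cs] xy ds by (simp add: obj_operad_def)
    qed
    then show "?k (sum_list ks) (Comp (arr_operad Q) ks a bs) =
        Comp (arr_operad W) ks (?k (length ks) a) (map2 ?k ks bs)"
      by (simp add: arr_operad_def)
  next
    show "?k 1 (Unit (arr_operad Q)) = Unit (arr_operad W)"
      using k_idn[of "OUnit Q" 1] h.dom.unit_closed h.hom_unit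
      by (simp add: arr_operad_def obj_operad_def)
  next
    fix \<sigma> n a assume \<sigma>: "\<sigma> permutes {..<n}" and "a \<in> Carr (arr_operad Q) n"
    then have a: "a \<in> Hom (Cat Q n) (Dom (Cat Q n) a) (Cod (Cat Q n) a)"
      by (simp add: arr_operad_def Hom_def)
    have "AAct Q n \<sigma> a \<in> Hom (Cat Q n) (OAct Q n \<sigma> (Dom (Cat Q n) a)) (OAct Q n \<sigma> (Cod (Cat Q n) a))"
      using cat_functor.functor_hom[OF Q.act_functor[OF \<sigma>]] a QO[OF a] by blast
    from k[OF this] act_hom[OF \<sigma> k[OF a]]
    have "?k n (AAct Q n \<sigma> a) = AAct W n \<sigma> (?k n a)"
      using h.hom_act[OF \<sigma>] QO[OF a] by (simp add: obj_operad_def thin)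
    then show "?k n (Act (arr_operad Q) n \<sigma> a) = Act (arr_operad W) n \<sigma> (?k n a)"
      by (simp add: arr_operad_def)
  qed
  ultimately show ?thesis
    by (intro cat_operad_map.intro cat_operad_map_axioms.intro sym_cat_operad_axioms) (use assms in auto)
qed

text \<open>
  Equal labels provide the components; naturality and the three operad conditions compare
  parallel arrows.
\<close>

lemma transformation_over_base:
  assumes "cat_operad_map Q W \<alpha>" "cat_operad_map Q W \<beta>"
    and lab: "\<And>n x. x \<in> Obj (Cat Q n) \<Longrightarrow> \<kappa> n (fst \<alpha> n x) = \<kappa> n (fst \<beta> n x)"
  shows "cat_operad_transformation Q W \<alpha> \<beta> (\<lambda>n x. arrow n (fst \<alpha> n x) (fst \<beta> n x))"
    (is "cat_operad_transformation Q W \<alpha> \<beta> ?\<eta>")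
proof -
  interpret \<alpha>: cat_operad_map Q W \<alpha> by fact
  interpret \<beta>: cat_operad_map Q W \<beta> by fact
  interpret \<alpha>o: operad_hom "obj_operad Q" "obj_operad W" "fst \<alpha>" by (rule \<alpha>.map_obj)
  interpret \<beta>o: operad_hom "obj_operad Q" "obj_operad W" "fst \<beta>" by (rule \<beta>.map_obj)
  have \<eta>: "?\<eta> n x \<in> Hom (Cat W n) (fst \<alpha> n x) (fst \<beta> n x)" if "x \<in> Obj (Cat Q n)" for n x
    using that \<alpha>o.hom_closed \<beta>o.hom_closed by (intro arrow_hom lab) (auto simp: obj_operad_def)
  show ?thesis
  proof (intro cat_operad_transformation.intro cat_operad_transformation_axioms.intro assms(1,2) \<eta>)
    fix a n x y assume a: "a \<in> Hom (Cat Q n) x y"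
    then have xy: "x \<in> Obj (Cat Q n)" "y \<in> Obj (Cat Q n)"
      using category.dom_closed[OF \<alpha>.dom.category] category.cod_closed[OF \<alpha>.dom.category]
      by (auto simp: Hom_def)
    note fa = cat_functor.functor_hom[OF \<alpha>.map_functor xy a]
      and fb = cat_functor.functor_hom[OF \<beta>.map_functor xy a]
    show "Cmp (Cat W n) (?\<eta> n y) (snd \<alpha> n a) = Cmp (Cat W n) (snd \<beta> n a) (?\<eta> n x)"
      using cmp_hom[OF fa \<eta>[OF xy(2)]] cmp_hom[OF \<eta>[OF xy(1)] fb] by (rule thin)
  next
    fix p ks ps assume p: "p \<in> Obj (Cat Q (length ks))" and ps: "args (\<lambda>k. Obj (Cat Q k)) ks ps"
    have len: "length ps = length ks" using ps by (simp add: list_all2_lengthD)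
    have c: "OComp Q ks p ps \<in> Obj (Cat Q (sum_list ks))"
      using \<alpha>o.dom.comp_closed[of p ks ps] p ps by (simp add: obj_operad_def)
    show "?\<eta> (sum_list ks) (OComp Q ks p ps) = AComp W ks (?\<eta> (length ks) p) (map2 ?\<eta> ks ps)"
    proof (rule thin[OF \<eta>[OF c]])
      have "AComp W ks (?\<eta> (length ks) p) (map2 ?\<eta> ks ps) \<in> Hom (Cat W (sum_list ks))
         (OComp W ks (fst \<alpha> (length ks) p) (map2 (fst \<alpha>) ks ps))
         (OComp W ks (fst \<beta> (length ks) p) (map2 (fst \<beta>) ks ps))"
        using \<eta>[OF p] len list_all2_nthD[OF ps] \<eta> by (intro acomp_hom') auto
      then show "AComp W ks (?\<eta> (length ks) p) (map2 ?\<eta> ks ps) \<in> Hom (Cat W (sum_list ks))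
         (fst \<alpha> (sum_list ks) (OComp Q ks p ps)) (fst \<beta> (sum_list ks) (OComp Q ks p ps))"
        using \<alpha>o.hom_comp[of p ks ps] \<beta>o.hom_comp[of p ks ps] p ps by (simp add: obj_operad_def)
    qed
  next
    have u: "OUnit Q \<in> Obj (Cat Q 1)" "OUnit W \<in> Obj (Cat W 1)"
      "fst \<alpha> 1 (OUnit Q) = OUnit W" "fst \<beta> 1 (OUnit Q) = OUnit W"
      using \<alpha>o.dom.unit_closed \<alpha>o.cod.unit_closed \<alpha>o.hom_unit \<beta>o.hom_unit
      by (simp_all add: obj_operad_def)
    show "?\<eta> 1 (OUnit Q) = Idn (Cat W 1) (OUnit W)"
      by (rule thin[OF \<eta>[OF u(1)]]) (unfold u(3,4), rule idn_hom[OF u(2)])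
  next
    fix \<sigma> n p assume \<sigma>: "\<sigma> permutes {..<n}" and p: "p \<in> Obj (Cat Q n)"
    then have "OAct Q n \<sigma> p \<in> Obj (Cat Q n)"
      using \<alpha>o.dom.act_closed[OF \<sigma>, of p] by (simp add: obj_operad_def)
    from \<eta>[OF this] act_hom[OF \<sigma> \<eta>[OF p]]
    show "?\<eta> n (OAct Q n \<sigma> p) = AAct W n \<sigma> (?\<eta> n p)"
      using \<alpha>o.hom_act[OF \<sigma>, of p] \<beta>o.hom_act[OF \<sigma>, of p] p by (simp add: obj_operad_def thin)
  qed
qed

lemma maps_over_base_isomorphic:
  assumes maps: "cat_operad_map Q W \<alpha>" "cat_operad_map Q W \<beta>"
    and lab: "\<And>n x. x \<in> Obj (Cat Q n) \<Longrightarrow> \<kappa> n (fst \<alpha> n x) = \<kappa> n (fst \<beta> n x)"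
  shows "isomorphic_maps Q W \<alpha> \<beta>"
proof -
  define \<eta> where "\<eta> n x = arrow n (fst \<alpha> n x) (fst \<beta> n x)" for n x
  define \<theta> where "\<theta> n x = arrow n (fst \<beta> n x) (fst \<alpha> n x)" for n x
  have \<eta>: "cat_operad_transformation Q W \<alpha> \<beta> \<eta>"
    unfolding \<eta>_def using maps lab by (rule transformation_over_base)
  have \<theta>: "cat_operad_transformation Q W \<beta> \<alpha> \<theta>"
    unfolding \<theta>_def using maps(2,1) lab[symmetric] by (rule transformation_over_base)
  have "Cmp (Cat W n) (\<theta> n x) (\<eta> n x) = Idn (Cat W n) (fst \<alpha> n x)"
    "Cmp (Cat W n) (\<eta> n x) (\<theta> n x) = Idn (Cat W n) (fst \<beta> n x)" if "x \<in> Obj (Cat Q n)" for n x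
  proof -
    note h = cat_operad_transformation.component[OF \<eta> that]
      cat_operad_transformation.component[OF \<theta> that]
    show "Cmp (Cat W n) (\<theta> n x) (\<eta> n x) = Idn (Cat W n) (fst \<alpha> n x)"
      using cmp_hom[OF h(1,2)] idn_hom Hom_Obj[OF h(1)] thin by blast
    show "Cmp (Cat W n) (\<eta> n x) (\<theta> n x) = Idn (Cat W n) (fst \<beta> n x)"
      using cmp_hom[OF h(2,1)] idn_hom Hom_Obj[OF h(1)] thin by blast
  qed
  then show ?thesis unfolding isomorphic_maps_def using \<eta> \<theta> by blast
qed

end

section \<open>Equivalence from morphisms on objects\<close>

lemma id_cat_operad_map:
  assumes "sym_cat_operad Q"
  shows "cat_operad_map Q Q id_map"
proof -
  interpret sym_cat_operad Q by fact
  have "cat_functor (Cat Q n) (Cat Q n) (\<lambda>x. x) (\<lambda>a. a)" for n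
    unfolding cat_functor_def cat_functor_axioms_def by (simp add: category)
  then show ?thesis
    unfolding cat_operad_map_def cat_operad_map_axioms_def id_map_def
    by (simp add: assms operad_hom_id obj_operad arr_operad)
qed

lemma cat_functor_comp:
  assumes "cat_functor C D fo fa" "cat_functor D E go ga"
  shows "cat_functor C E (\<lambda>x. go (fo x)) (\<lambda>a. ga (fa a))"
proof -
  interpret f: cat_functor C D fo fa by fact
  interpret g: cat_functor D E go ga by fact
  have C: "x \<in> Obj C" "y \<in> Obj C" if "a \<in> Hom C x y" for a x y
    using that f.dom.dom_closed f.dom.cod_closed by (auto simp: Hom_def)
  show ?thesis
  proof
    fix a b x y z assume "a \<in> Hom C x y" "b \<in> Hom C y z"
    then show "ga (fa (Cmp C b a)) = Cmp E (ga (fa b)) (ga (fa a))"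
      using f.functor_cmp f.functor_hom C g.functor_cmp by metis
  qed (use f.functor_obj g.functor_obj f.functor_hom g.functor_hom f.functor_idn g.functor_idn in auto)
qed

lemma comp_cat_operad_map:
  assumes "cat_operad_map P Q \<alpha>" "cat_operad_map Q R \<beta>"
  shows "cat_operad_map P R (comp_map \<beta> \<alpha>)"
proof -
  interpret \<alpha>: cat_operad_map P Q \<alpha> by fact
  interpret \<beta>: cat_operad_map Q R \<beta> by fact
  show ?thesis
    unfolding cat_operad_map_def cat_operad_map_axioms_def comp_map_def
    using \<alpha>.dom.sym_cat_operad_axioms \<beta>.cod.sym_cat_operad_axioms
      cat_functor_comp[OF \<alpha>.map_functor \<beta>.map_functor]
      operad_hom_comp[OF \<alpha>.map_obj \<beta>.map_obj] operad_hom_comp[OF \<alpha>.map_arr \<beta>.map_arr]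
    by simp
qed

text \<open>
  The morphisms \<open>h\<close> and \<open>k\<close> need not be mutually inverse: both composites preserve labels, as
  the identities do, and this is enough for them to be isomorphic to the identities.
\<close>

lemma equivalent_over_base:
  assumes W: "thin_cat_operad W \<kappa>" and W': "thin_cat_operad W' \<kappa>'"
    and h: "operad_hom (obj_operad W) (obj_operad W') h"
      "\<And>n x. x \<in> Obj (Cat W n) \<Longrightarrow> \<kappa>' n (h n x) = \<kappa> n x"
    and k: "operad_hom (obj_operad W') (obj_operad W) k"
      "\<And>n x. x \<in> Obj (Cat W' n) \<Longrightarrow> \<kappa> n (k n x) = \<kappa>' n x"
  shows "equivalent_cat_operads W W'"
proof -
  interpret W: thin_cat_operad W \<kappa> by fact
  interpret W': thin_cat_operad W' \<kappa>' by fact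
  have "\<kappa>' n (h n x) = \<kappa>' n (h n y)" if "a \<in> Hom (Cat W n) x y" for n x y a
    using W.Hom_Obj[OF that] W.arrow_label[OF that] h(2) by simp
  from W'.extend_map[OF W.sym_cat_operad_axioms h(1) this]
  obtain \<alpha> where \<alpha>: "cat_operad_map W W' \<alpha>" "fst \<alpha> = h" by fastforce
  have "\<kappa> n (k n x) = \<kappa> n (k n y)" if "a \<in> Hom (Cat W' n) x y" for n x y a
    using W'.Hom_Obj[OF that] W'.arrow_label[OF that] k(2) by simp
  from W.extend_map[OF W'.sym_cat_operad_axioms k(1) this]
  obtain \<beta> where \<beta>: "cat_operad_map W' W \<beta>" "fst \<beta> = k" by fastforce
  have ho: "h n x \<in> Obj (Cat W' n)" if "x \<in> Obj (Cat W n)" for n x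
    using operad_hom.hom_closed[OF h(1), of x n] that by (simp add: obj_operad_def)
  have ko: "k n x \<in> Obj (Cat W n)" if "x \<in> Obj (Cat W' n)" for n x
    using operad_hom.hom_closed[OF k(1), of x n] that by (simp add: obj_operad_def)
  have "isomorphic_maps W W id_map (comp_map \<beta> \<alpha>)"
    using id_cat_operad_map[OF W.sym_cat_operad_axioms] comp_cat_operad_map[OF \<alpha>(1) \<beta>(1)]
    by (rule W.maps_over_base_isomorphic) (simp add: id_map_def comp_map_def \<alpha> \<beta> h(2) k(2) ho)
  moreover have "isomorphic_maps W' W' (comp_map \<alpha> \<beta>) id_map"
    using comp_cat_operad_map[OF \<beta>(1) \<alpha>(1)] id_cat_operad_map[OF W'.sym_cat_operad_axioms]
    by (rule W'.maps_over_base_isomorphic) (simp add: id_map_def comp_map_def \<alpha> \<beta> h(2) k(2) ko)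
  ultimately show ?thesis unfolding equivalent_cat_operads_def using \<alpha>(1) \<beta>(1) by blast
qed

section \<open>Projectivity of free operads\<close>

lemma operad_hom_inverse:
  assumes "operad_hom X Y b" and bij: "\<And>n. bij_betw (b n) (Carr X n) (Carr Y n)"
  shows "operad_hom Y X (\<lambda>n. inv_into (Carr X n) (b n))" (is "operad_hom Y X ?c")
proof -
  interpret b: operad_hom X Y b by fact
  have c: "?c n y \<in> Carr X n" "b n (?c n y) = y" if "y \<in> Carr Y n" for n y
    using bij[of n] that by (auto simp: bij_betw_def inv_into_into f_inv_into_f)
  have cb: "?c n z = x" if "x \<in> Carr X n" "z = b n x" for n x z
    using bij[of n] that by (simp add: bij_betw_def)
  show ?thesis
  proof
    fix p ks qs assume p: "p \<in> Carr Y (length ks)" and qs: "args (Carr Y) ks qs"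
    have len: "length qs = length ks" using qs by (simp add: list_all2_lengthD)
    have a: "args (Carr X) ks (map2 ?c ks qs)"
      using qs by (auto simp: list_all2_conv_all_nth c)
    have "map2 b ks (map2 ?c ks qs) = qs"
      using list_all2_nthD[OF qs] len c by (intro nth_equalityI) auto
    then show "?c (sum_list ks) (Comp Y ks p qs) = Comp X ks (?c (length ks) p) (map2 ?c ks qs)"
      using b.hom_comp[OF c(1)[OF p] a] c(2)[OF p] b.dom.comp_closed[OF c(1)[OF p] a]
      by (intro cb) simp_all
  next
    show "?c 1 (Unit Y) = Unit X"
      using b.dom.unit_closed b.hom_unit by (intro cb) simp_all
  next
    fix \<sigma> n p assume "\<sigma> permutes {..<n}" "p \<in> Carr Y n"
    then show "?c n (Act Y n \<sigma> p) = Act X n \<sigma> (?c n p)"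
      using c by (intro cb) (simp_all add: b.dom.act_closed b.hom_act)
  qed (rule c)
qed

text \<open>
  Choose a preimage of the value at each generator and extend by freeness; the extension lies
  over \<open>\<phi>\<close> since both agree on generators.
\<close>

lemma free_operad_projective:
  assumes \<phi>: "operad_hom (free_operad \<Phi>) P \<phi>" and f: "operad_hom X P f"
    and surj: "\<And>n. Carr P n \<subseteq> f n ` Carr X n"
  obtains g where "operad_hom (free_operad \<Phi>) X g"
    "\<And>n t. t \<in> Carr (free_operad \<Phi>) n \<Longrightarrow> f n (g n t) = \<phi> n t"
proof -
  define h where "h n s = inv_into (Carr X n) (f n) (\<phi> n (gen n s))" for n s
  have "\<phi> n (gen n s) \<in> f n ` Carr X n" if "s \<in> \<Phi> n" for n s
    using operad_hom.hom_closed[OF \<phi> gen_closed[of s \<Phi> n, OF that]] surj by blast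
  then have h: "h n s \<in> Carr X n" "f n (h n s) = \<phi> n (gen n s)" if "s \<in> \<Phi> n" for n s
    using that by (simp_all add: h_def inv_into_into f_inv_into_f)
  have X: "symmetric_operad X" using f by (simp add: operad_hom_def)
  have g: "operad_hom (free_operad \<Phi>) X (free_lift X h)"
    "\<And>n s. s \<in> \<Phi> n \<Longrightarrow> free_lift X h n (gen n s) = h n s"
    using free_operad_universal(1,2)[OF X, of \<Phi> h] h(1) by auto
  have "f n (free_lift X h n t) = \<phi> n t" if "t \<in> Carr (free_operad \<Phi>) n" for n t
    by (rule free_hom_unique[OF operad_hom_comp[OF g(1) f] \<phi> _ that]) (simp add: g(2) h(2))
  with g(1) show thesis by (rule that)
qed

section \<open>Weakenings over surjective presentations\<close>

text \<open>
  The morphism \<open>c\<close> is the inverse of the comparison on objects: it exhibits the operad of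
  objects of \<open>W\<close> as free, so that lifts can be constructed on the free operad.
\<close>

lemma weakening_structure:
  assumes "is_weakening \<Phi> P \<phi> W"
  obtains f c where "thin_cat_operad W f" "operad_hom (obj_operad W) P f"
    and "\<And>n. f n ` Obj (Cat W n) = \<phi> n ` Carr (free_operad \<Phi>) n"
    and "operad_hom (obj_operad W) (free_operad \<Phi>) c"
    and "\<And>n x. x \<in> Obj (Cat W n) \<Longrightarrow> \<phi> n (c n x) = f n x"
proof -
  obtain b f where b: "cat_operad_map (discrete_operad (free_operad \<Phi>)) W b"
    and f: "cat_operad_map W (discrete_operad P) f"
    and fb: "\<And>n t. t \<in> Carr (free_operad \<Phi>) n \<Longrightarrow> fst f n (fst b n t) = \<phi> n t"
    and bij: "\<And>n. bij_betw (fst b n) (Carr (free_operad \<Phi>) n) (Obj (Cat W n))"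
    and ff: "full_and_faithful W (discrete_operad P) f"
    using assms unfolding is_weakening_def bijective_on_objects_def comp_map_def
    \<comment> \<open>\<open>Cat (discrete_operad _) n\<close> has to stay folded for its objects to simplify to \<open>Carr\<close>\<close>
    by (auto simp del: discrete_operad_sel(13))
  interpret f: cat_operad_map W "discrete_operad P" f by fact
  have fo: "operad_hom (obj_operad W) P (fst f)" using f.map_obj by simp
  have fin: "fst f n x \<in> Carr P n" if "x \<in> Obj (Cat W n)" for n x
    using operad_hom.hom_closed[OF fo, of x n] that by (simp add: obj_operad_def)
  \<comment> \<open>In a discrete category the identity of \<open>x\<close> is \<open>x\<close> itself.\<close>
  have hP: "Hom (Cat (discrete_operad P) n) x y = (if x = y then {x} \<inter> Carr P n else {})" for n x y
    by (auto simp: Hom_def discrete_category_def)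
  have WH: "bij_betw (snd f n) (Hom (Cat W n) x y) (if fst f n x = fst f n y then {fst f n x} else {})"
    if "x \<in> Obj (Cat W n)" "y \<in> Obj (Cat W n)" for n x y
    using ff that fin[OF that(1)] unfolding full_and_faithful_def hP by fastforce
  have thin: "thin_cat_operad W (fst f)"
  proof (intro thin_cat_operad.intro thin_cat_operad_axioms.intro f.dom.sym_cat_operad_axioms)
    fix x y n assume *: "x \<in> Obj (Cat W n)" "y \<in> Obj (Cat W n)" "fst f n x = fst f n y"
    then have "bij_betw (snd f n) (Hom (Cat W n) x y) {fst f n x}" using WH[OF *(1,2)] by simp
    then have "card (Hom (Cat W n) x y) = 1" by (simp add: bij_betw_same_card)
    then obtain a where "Hom (Cat W n) x y = {a}" by (rule card_1_singletonE)
    then show "\<exists>!a. a \<in> Hom (Cat W n) x y" by simp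
  next
    fix a n x y assume a: "a \<in> Hom (Cat W n) x y"
    then have "x \<in> Obj (Cat W n)" "y \<in> Obj (Cat W n)"
      using category.dom_closed[OF f.dom.category] category.cod_closed[OF f.dom.category]
      by (auto simp: Hom_def)
    from WH[OF this] a show "fst f n x = fst f n y"
      by (auto simp: bij_betw_def split: if_splits)
  qed
  have bo: "operad_hom (free_operad \<Phi>) (obj_operad W) (fst b)"
    using cat_operad_map.map_obj[OF b] by simp
  have im: "fst b n ` Carr (free_operad \<Phi>) n = Obj (Cat W n)" for n
    using bij by (simp add: bij_betw_def)
  let ?c = "\<lambda>n. inv_into (Carr (free_operad \<Phi>) n) (fst b n)"
  have c: "operad_hom (obj_operad W) (free_operad \<Phi>) ?c"
    using bij by (intro operad_hom_inverse bo) (simp add: obj_operad_def)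
  have cO: "?c n x \<in> Carr (free_operad \<Phi>) n" "fst b n (?c n x) = x" if "x \<in> Obj (Cat W n)" for n x
    using that im[of n] by (auto simp: inv_into_into f_inv_into_f)
  show thesis
  proof (rule that[OF thin fo _ c])
    show "fst f n ` Obj (Cat W n) = \<phi> n ` Carr (free_operad \<Phi>) n" for n
      unfolding im[symmetric] image_image using fb by (intro image_cong) auto
    show "\<phi> n (?c n x) = fst f n x" if "x \<in> Obj (Cat W n)" for n x
      using fb[OF cO(1)[OF that]] cO(2)[OF that] by simp
  qed
qed

lemma surjective_weakenings_equivalent:
  assumes W: "is_weakening \<Phi> P \<phi> W" and W': "is_weakening \<Psi> P \<psi> W'"
    and \<phi>: "operad_hom (free_operad \<Phi>) P \<phi>" and \<psi>: "operad_hom (free_operad \<Psi>) P \<psi>"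
    and surj: "\<And>n. Carr P n \<subseteq> \<phi> n ` Carr (free_operad \<Phi>) n"
      "\<And>n. Carr P n \<subseteq> \<psi> n ` Carr (free_operad \<Psi>) n"
  shows "equivalent_cat_operads W W'"
proof -
  obtain f c where f: "thin_cat_operad W f" "operad_hom (obj_operad W) P f"
    "\<And>n. f n ` Obj (Cat W n) = \<phi> n ` Carr (free_operad \<Phi>) n"
    and c: "operad_hom (obj_operad W) (free_operad \<Phi>) c"
    "\<And>n x. x \<in> Obj (Cat W n) \<Longrightarrow> \<phi> n (c n x) = f n x"
    using W by (rule weakening_structure) (rule that)
  obtain f' c' where f': "thin_cat_operad W' f'" "operad_hom (obj_operad W') P f'"
    "\<And>n. f' n ` Obj (Cat W' n) = \<psi> n ` Carr (free_operad \<Psi>) n"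
    and c': "operad_hom (obj_operad W') (free_operad \<Psi>) c'"
    "\<And>n x. x \<in> Obj (Cat W' n) \<Longrightarrow> \<psi> n (c' n x) = f' n x"
    using W' by (rule weakening_structure) (rule that)
  have s: "Carr P n \<subseteq> f n ` Carr (obj_operad W) n"
    "Carr P n \<subseteq> f' n ` Carr (obj_operad W') n" for n
    using surj f(3) f'(3) by (simp_all add: obj_operad_def)
  obtain g where g: "operad_hom (free_operad \<Phi>) (obj_operad W') g"
    "\<And>n t. t \<in> Carr (free_operad \<Phi>) n \<Longrightarrow> f' n (g n t) = \<phi> n t"
    by (rule free_operad_projective[OF \<phi> f'(2) s(2)]) (rule that)
  obtain g' where g': "operad_hom (free_operad \<Psi>) (obj_operad W) g'"
    "\<And>n t. t \<in> Carr (free_operad \<Psi>) n \<Longrightarrow> f n (g' n t) = \<psi> n t"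
    by (rule free_operad_projective[OF \<psi> f(2) s(1)]) (rule that)
  have cc: "c n x \<in> Carr (free_operad \<Phi>) n" if "x \<in> Obj (Cat W n)" for n x
    using operad_hom.hom_closed[OF c(1), of x n] that by (simp add: obj_operad_def)
  have cc': "c' n x \<in> Carr (free_operad \<Psi>) n" if "x \<in> Obj (Cat W' n)" for n x
    using operad_hom.hom_closed[OF c'(1), of x n] that by (simp add: obj_operad_def)
  show ?thesis
  proof (rule equivalent_over_base[OF f(1) f'(1)
        operad_hom_comp[OF c(1) g(1)] _ operad_hom_comp[OF c'(1) g'(1)]])
    show "f' n (g n (c n x)) = f n x" if "x \<in> Obj (Cat W n)" for n x
      using g(2)[OF cc[OF that]] c(2)[OF that] by simp
    show "f n (g' n (c' n x)) = f' n x" if "x \<in> Obj (Cat W' n)" for n x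
      using g'(2)[OF cc'[OF that]] c'(2)[OF that] by simp
  qed
qed

text \<open>
  It remains to see that the two presentations of \<open>P\<close> are surjective: \<open>\<phi>\<close> is a coequalizer,
  and the counit maps the generator \<open>p\<close> to \<open>p\<close>.
\<close>

theorem theorem5p3p2:
  fixes P :: "'a sym_operad"
    and \<Phi> :: "nat \<Rightarrow> 'f set"
    and \<phi> :: "nat \<Rightarrow> 'f tm \<Rightarrow> 'a"
    and W :: "('o, 'm) cat_operad"
    and W' :: "('o2, 'm2) cat_operad"
  assumes "symmetric_operad P"
    and "operad_hom (free_operad \<Phi>) P \<phi>"
    and "regular_epi TYPE('c) (free_operad \<Phi>) P \<phi>"
    and "is_weakening \<Phi> P \<phi> W"
    and "is_unbiased_weakening P W'"
  shows "equivalent_cat_operads W W'"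
proof (rule surjective_weakenings_equivalent[OF assms(4) _ assms(2) counit_hom(1)[OF assms(1)]])
  show "is_weakening (Carr P) P (counit P) W'"
    using assms(5) by (simp add: is_unbiased_weakening_def)
  show "Carr P n \<subseteq> \<phi> n ` Carr (free_operad \<Phi>) n" for n
    using assms(3) unfolding regular_epi_def by (auto intro: coequalizer_surj)
  show "Carr P n \<subseteq> counit P n ` Carr (free_operad (Carr P)) n" for n
  proof
    fix p assume p: "p \<in> Carr P n"
    show "p \<in> counit P n ` Carr (free_operad (Carr P)) n"
      using counit_hom(2)[OF assms(1) p] gen_closed[of p "Carr P" n, OF p] by (metis imageI)
  qed
qed

end
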